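(* Let $HW(\mathcal{M})$ be a given hereditarily finite list superstructure (with a polynomial-time computable representation in which the values of standard list terms are polynomial-time computable). Then for every $k\geqslant 1$ the set of $\Delta_0$+Rec sentences true in $HW(\mathcal{M})$ is $k\text{-}\mathsf{EXPTIME}$-hard (under polynomial-time many-one reductions), and hence this set is non-elementary. Consequently, there is no polynomial $p$ such that every $\Delta_0$+Rec formula $\varphi$ is equivalent to a $\Delta_0$-formula $\psi$ with $|\psi|\leqslant p(|\varphi|)$.
   Context: The language of $\Delta_0$-formulas is a two-sorted first-order language with sorts "urelement" and "list", with constants of sort urelement, a constant $nil$ (empty list), list functions $head, tail, cons, conc$, binary predicates $\in,\sqsubseteq$, equality, possibly further predicate symbols, and no other function symbols. Constant lists are finite, possibly nested, lists over urelements and $nil$; list terms are built from constant lists, list variables and list functions. Interpretation is in the hereditarily finite list superstructure $HW(\mathcal{M})$: $head(s)$ is the last element of $s$ ($nil$ if $s=nil$), $tail(s)$ is $s$ without its last element ($nil$ if $s=nil$), $cons(s,a)$ appends $a$ as new last element, $conc$ is concatenation, $\in$ is membership in a list and $\sqsubseteq$ is being an initial segment. $\Delta_0$-formulas are built from atomic formulas by Boolean connectives and bounded quantifiers $\forall x\in t,\exists x\in t,\forall x\sqsubseteq t,\exists x\sqsubseteq t$ with $t$ a variable-free list term. $\Delta_0$+Rec adds recursive terms: if $f(\overline{v}),h(\overline{v},y,z),t(\overline{v})$ are $\Delta_0$+Rec list terms, then $Rec[f,h,t](\overline{v})$ is a list term with value $g(\overline{v},t)$, where $g(\overline{v},nil)=f(\overline{v})$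 and $g(\overline{v},cons(\alpha,b))=h(\overline{v},g(\overline{v},\alpha),b)$ for all $\alpha,b$ with $cons(\alpha,b)\sqsubseteq t$. Two formulas are equivalent if they have the same truth value in every $HW(\mathcal{M})$ under every assignment. $|\varphi|$ is the length of the string representing $\varphi$. $\exp_1(n)=2^n$, $\exp_{k+1}(n)=2^{\exp_k(n)}$; $k\text{-}\mathsf{EXPTIME}$ is the class of sets decidable by a deterministic Turing machine in time $\exp_k(p(|x|))$ for a polynomial $p$. *)

theory Defs
  imports Complex_Main "HOL-Library.Sublist" "HOL-Computational_Algebra.Polynomial"
begin

section \<open>The hereditarily finite list superstructure\<close>

text \<open>
  The domain of the superstructure over a set of urelements \<open>'u\<close> consists of the urelements and of
  all finite nested lists over them; \<open>Ls []\<close> is the empty list.  The last element of an object-level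
  list is the last element of the HOL list.
\<close>

datatype 'u hw = Ur 'u | Ls "'u hw list"

text \<open>
  The last element of a list may be an urelement, so a list term such as \<open>tail (head s)\<close> may apply
  a list function to an urelement.  In such a position an urelement is treated as the empty list.
\<close>

fun elems :: "'u hw \<Rightarrow> 'u hw list" where
  "elems (Ur a) = []"
| "elems (Ls xs) = xs"

definition hw_head :: "'u hw \<Rightarrow> 'u hw" where
  "hw_head s = (if elems s = [] then Ls [] else last (elems s))"

definition hw_tail :: "'u hw \<Rightarrow> 'u hw" where
  "hw_tail s = Ls (butlast (elems s))"

definition hw_cons :: "'u hw \<Rightarrow> 'u hw \<Rightarrow> 'u hw" where
  "hw_cons s a = Ls (elems s @ [a])"

definition hw_conc :: "'u hw \<Rightarrow> 'u hw \<Rightarrow> 'u hw" where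
  "hw_conc s t = Ls (elems s @ elems t)"

definition hw_mem :: "'u hw \<Rightarrow> 'u hw \<Rightarrow> bool" where
  "hw_mem a s \<longleftrightarrow> (\<exists>xs. s = Ls xs \<and> a \<in> set xs)"

definition hw_init :: "'u hw \<Rightarrow> 'u hw \<Rightarrow> bool" where
  "hw_init s t \<longleftrightarrow> (\<exists>xs ys. s = Ls xs \<and> t = Ls ys \<and> prefix xs ys)"

definition is_ur :: "'u hw \<Rightarrow> bool" where
  "is_ur a \<longleftrightarrow> (\<exists>u. a = Ur u)"


section \<open>Syntax\<close>

text \<open>
  Urelement constants and additional predicate symbols are indexed by natural numbers; a signature
  tells which of them are present, and the arities of the predicates.
\<close>

record signature =
  const_syms :: "nat set"
  pred_syms :: "nat set"
  arity :: "nat \<Rightarrow> nat"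

datatype var = UV nat | LV nat

datatype uterm = UConst nat | UVar nat

text \<open>
  \<open>LConst\<close> is a constant list over constant symbols; \<open>LConst []\<close> is the constant \<open>nil\<close>.
  \<open>LRec f y z h t\<close> is the recursive term \<open>Rec[f,h,t]\<close>, in which the list variables \<open>y\<close> and \<open>z\<close> are
  the two distinguished arguments of \<open>h\<close>; they are bound in \<open>h\<close> only.  Its parameters are
  its free variables.
\<close>

datatype lterm =
    LConst "nat hw list"
  | LVar nat
  | LHead lterm
  | LTail lterm
  | LCons lterm "term"
  | LConc lterm lterm
  | LRec lterm nat nat lterm lterm
and "term" = TU uterm | TL lterm

datatype fm =
    Eq "term" "term"
  | Mem "term" lterm
  | Init lterm lterm
  | Pred nat "term list"
  | Neg fm
  | Conj fm fm
  | Disj fm fm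
  | Imp fm fm
  | AllMem var lterm fm
  | ExMem var lterm fm
  | AllInit nat lterm fm
  | ExInit nat lterm fm

primrec fv_uterm :: "uterm \<Rightarrow> var set" where
  "fv_uterm (UConst c) = {}"
| "fv_uterm (UVar n) = {UV n}"

primrec fv_lterm :: "lterm \<Rightarrow> var set" and fv_term :: "term \<Rightarrow> var set" where
  "fv_lterm (LConst cs) = {}"
| "fv_lterm (LVar n) = {LV n}"
| "fv_lterm (LHead s) = fv_lterm s"
| "fv_lterm (LTail s) = fv_lterm s"
| "fv_lterm (LCons s a) = fv_lterm s \<union> fv_term a"
| "fv_lterm (LConc s t) = fv_lterm s \<union> fv_lterm t"
| "fv_lterm (LRec f y z h t) = fv_lterm f \<union> (fv_lterm h - {LV y, LV z}) \<union> fv_lterm t"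
| "fv_term (TU u) = fv_uterm u"
| "fv_term (TL t) = fv_lterm t"

primrec fv_fm :: "fm \<Rightarrow> var set" where
  "fv_fm (Eq a b) = fv_term a \<union> fv_term b"
| "fv_fm (Mem a t) = fv_term a \<union> fv_lterm t"
| "fv_fm (Init s t) = fv_lterm s \<union> fv_lterm t"
| "fv_fm (Pred P as) = (\<Union>a\<in>set as. fv_term a)"
| "fv_fm (Neg \<phi>) = fv_fm \<phi>"
| "fv_fm (Conj \<phi> \<psi>) = fv_fm \<phi> \<union> fv_fm \<psi>"
| "fv_fm (Disj \<phi> \<psi>) = fv_fm \<phi> \<union> fv_fm \<psi>"
| "fv_fm (Imp \<phi> \<psi>) = fv_fm \<phi> \<union> fv_fm \<psi>"
| "fv_fm (AllMem x t \<phi>) = fv_lterm t \<union> (fv_fm \<phi> - {x})"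
| "fv_fm (ExMem x t \<phi>) = fv_lterm t \<union> (fv_fm \<phi> - {x})"
| "fv_fm (AllInit n t \<phi>) = fv_lterm t \<union> (fv_fm \<phi> - {LV n})"
| "fv_fm (ExInit n t \<phi>) = fv_lterm t \<union> (fv_fm \<phi> - {LV n})"

primrec uterm_ok :: "signature \<Rightarrow> uterm \<Rightarrow> bool" where
  "uterm_ok \<Sigma> (UConst c) \<longleftrightarrow> c \<in> const_syms \<Sigma>"
| "uterm_ok \<Sigma> (UVar n) \<longleftrightarrow> True"

text \<open>Terms of the language over \<open>\<Sigma>\<close>, with recursive terms.\<close>

primrec lterm_ok :: "signature \<Rightarrow> lterm \<Rightarrow> bool" and term_ok :: "signature \<Rightarrow> term \<Rightarrow> bool" where
  "lterm_ok \<Sigma> (LConst cs) \<longleftrightarrow> (\<forall>c\<in>set cs. set_hw c \<subseteq> const_syms \<Sigma>)"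
| "lterm_ok \<Sigma> (LVar n) \<longleftrightarrow> True"
| "lterm_ok \<Sigma> (LHead s) \<longleftrightarrow> lterm_ok \<Sigma> s"
| "lterm_ok \<Sigma> (LTail s) \<longleftrightarrow> lterm_ok \<Sigma> s"
| "lterm_ok \<Sigma> (LCons s a) \<longleftrightarrow> lterm_ok \<Sigma> s \<and> term_ok \<Sigma> a"
| "lterm_ok \<Sigma> (LConc s t) \<longleftrightarrow> lterm_ok \<Sigma> s \<and> lterm_ok \<Sigma> t"
| "lterm_ok \<Sigma> (LRec f y z h t) \<longleftrightarrow> y \<noteq> z \<and> lterm_ok \<Sigma> f \<and> lterm_ok \<Sigma> h \<and> lterm_ok \<Sigma> t"
| "term_ok \<Sigma> (TU u) \<longleftrightarrow> uterm_ok \<Sigma> u"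
| "term_ok \<Sigma> (TL t) \<longleftrightarrow> lterm_ok \<Sigma> t"

text \<open>Standard terms are those without recursive terms.\<close>

primrec standard_lterm :: "lterm \<Rightarrow> bool" and standard_term :: "term \<Rightarrow> bool" where
  "standard_lterm (LConst cs) \<longleftrightarrow> True"
| "standard_lterm (LVar n) \<longleftrightarrow> True"
| "standard_lterm (LHead s) \<longleftrightarrow> standard_lterm s"
| "standard_lterm (LTail s) \<longleftrightarrow> standard_lterm s"
| "standard_lterm (LCons s a) \<longleftrightarrow> standard_lterm s \<and> standard_term a"
| "standard_lterm (LConc s t) \<longleftrightarrow> standard_lterm s \<and> standard_lterm t"
| "standard_lterm (LRec f y z h t) \<longleftrightarrow> False"
| "standard_term (TU u) \<longleftrightarrow> True"
| "standard_term (TL t) \<longleftrightarrow> standard_lterm t"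

text \<open>\<open>\<Delta>\<^sub>0\<close>+Rec formulas: the bounds of the quantifiers are variable-free.\<close>

primrec delta0_rec :: "signature \<Rightarrow> fm \<Rightarrow> bool" where
  "delta0_rec \<Sigma> (Eq a b) \<longleftrightarrow> term_ok \<Sigma> a \<and> term_ok \<Sigma> b"
| "delta0_rec \<Sigma> (Mem a t) \<longleftrightarrow> term_ok \<Sigma> a \<and> lterm_ok \<Sigma> t"
| "delta0_rec \<Sigma> (Init s t) \<longleftrightarrow> lterm_ok \<Sigma> s \<and> lterm_ok \<Sigma> t"
| "delta0_rec \<Sigma> (Pred P as) \<longleftrightarrow>
     P \<in> pred_syms \<Sigma> \<and> length as = arity \<Sigma> P \<and> (\<forall>a\<in>set as. term_ok \<Sigma> a)"
| "delta0_rec \<Sigma> (Neg \<phi>) \<longleftrightarrow> delta0_rec \<Sigma> \<phi>"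
| "delta0_rec \<Sigma> (Conj \<phi> \<psi>) \<longleftrightarrow> delta0_rec \<Sigma> \<phi> \<and> delta0_rec \<Sigma> \<psi>"
| "delta0_rec \<Sigma> (Disj \<phi> \<psi>) \<longleftrightarrow> delta0_rec \<Sigma> \<phi> \<and> delta0_rec \<Sigma> \<psi>"
| "delta0_rec \<Sigma> (Imp \<phi> \<psi>) \<longleftrightarrow> delta0_rec \<Sigma> \<phi> \<and> delta0_rec \<Sigma> \<psi>"
| "delta0_rec \<Sigma> (AllMem x t \<phi>) \<longleftrightarrow> lterm_ok \<Sigma> t \<and> fv_lterm t = {} \<and> delta0_rec \<Sigma> \<phi>"
| "delta0_rec \<Sigma> (ExMem x t \<phi>) \<longleftrightarrow> lterm_ok \<Sigma> t \<and> fv_lterm t = {} \<and> delta0_rec \<Sigma> \<phi>"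
| "delta0_rec \<Sigma> (AllInit n t \<phi>) \<longleftrightarrow> lterm_ok \<Sigma> t \<and> fv_lterm t = {} \<and> delta0_rec \<Sigma> \<phi>"
| "delta0_rec \<Sigma> (ExInit n t \<phi>) \<longleftrightarrow> lterm_ok \<Sigma> t \<and> fv_lterm t = {} \<and> delta0_rec \<Sigma> \<phi>"

primrec standard_fm :: "fm \<Rightarrow> bool" where
  "standard_fm (Eq a b) \<longleftrightarrow> standard_term a \<and> standard_term b"
| "standard_fm (Mem a t) \<longleftrightarrow> standard_term a \<and> standard_lterm t"
| "standard_fm (Init s t) \<longleftrightarrow> standard_lterm s \<and> standard_lterm t"
| "standard_fm (Pred P as) \<longleftrightarrow> (\<forall>a\<in>set as. standard_term a)"
| "standard_fm (Neg \<phi>) \<longleftrightarrow> standard_fm \<phi>"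
| "standard_fm (Conj \<phi> \<psi>) \<longleftrightarrow> standard_fm \<phi> \<and> standard_fm \<psi>"
| "standard_fm (Disj \<phi> \<psi>) \<longleftrightarrow> standard_fm \<phi> \<and> standard_fm \<psi>"
| "standard_fm (Imp \<phi> \<psi>) \<longleftrightarrow> standard_fm \<phi> \<and> standard_fm \<psi>"
| "standard_fm (AllMem x t \<phi>) \<longleftrightarrow> standard_lterm t \<and> standard_fm \<phi>"
| "standard_fm (ExMem x t \<phi>) \<longleftrightarrow> standard_lterm t \<and> standard_fm \<phi>"
| "standard_fm (AllInit n t \<phi>) \<longleftrightarrow> standard_lterm t \<and> standard_fm \<phi>"
| "standard_fm (ExInit n t \<phi>) \<longleftrightarrow> standard_lterm t \<and> standard_fm \<phi>"

definition delta0 :: "signature \<Rightarrow> fm \<Rightarrow> bool" where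
  "delta0 \<Sigma> \<phi> \<longleftrightarrow> delta0_rec \<Sigma> \<phi> \<and> standard_fm \<phi>"


section \<open>Semantics\<close>

text \<open>
  A structure with domain the type \<open>'u\<close>, together with the interpretation of the additional
  predicate symbols, which may take arguments of either sort.
\<close>

record 'u struct =
  const_val :: "nat \<Rightarrow> 'u"
  pred_val :: "nat \<Rightarrow> 'u hw list \<Rightarrow> bool"

type_synonym 'u assignment = "var \<Rightarrow> 'u hw"

fun has_sort :: "var \<Rightarrow> 'u hw \<Rightarrow> bool" where
  "has_sort (UV n) a \<longleftrightarrow> is_ur a"
| "has_sort (LV n) a \<longleftrightarrow> \<not> is_ur a"

definition sorted_assignment :: "'u assignment \<Rightarrow> bool" where
  "sorted_assignment e \<longleftrightarrow> (\<forall>x. has_sort x (e x))"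

primrec uval :: "'u struct \<Rightarrow> uterm \<Rightarrow> 'u assignment \<Rightarrow> 'u hw" where
  "uval M (UConst c) e = Ur (const_val M c)"
| "uval M (UVar n) e = e (UV n)"

text \<open>
  The fold is the recursion \<open>g(nil) = f\<close>, \<open>g(cons(\<alpha>,b)) = h(g(\<alpha>),b)\<close> along the initial segments of
  the value of \<open>t\<close>.  Here \<open>b\<close> may be an urelement; it is passed to \<open>h\<close> unchanged.
\<close>

primrec lval :: "'u struct \<Rightarrow> lterm \<Rightarrow> 'u assignment \<Rightarrow> 'u hw"
  and tval :: "'u struct \<Rightarrow> term \<Rightarrow> 'u assignment \<Rightarrow> 'u hw" where
  "lval M (LConst cs) e = Ls (map (map_hw (const_val M)) cs)"
| "lval M (LVar n) e = e (LV n)"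
| "lval M (LHead s) e = hw_head (lval M s e)"
| "lval M (LTail s) e = hw_tail (lval M s e)"
| "lval M (LCons s a) e = hw_cons (lval M s e) (tval M a e)"
| "lval M (LConc s t) e = hw_conc (lval M s e) (lval M t e)"
| "lval M (LRec f y z h t) e =
     foldl (\<lambda>g b. lval M h (e(LV y := g, LV z := b))) (lval M f e) (elems (lval M t e))"
| "tval M (TU u) e = uval M u e"
| "tval M (TL t) e = lval M t e"

primrec sat :: "'u struct \<Rightarrow> fm \<Rightarrow> 'u assignment \<Rightarrow> bool" where
  "sat M (Eq a b) e \<longleftrightarrow> tval M a e = tval M b e"
| "sat M (Mem a t) e \<longleftrightarrow> hw_mem (tval M a e) (lval M t e)"
| "sat M (Init s t) e \<longleftrightarrow> hw_init (lval M s e) (lval M t e)"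
| "sat M (Pred P as) e \<longleftrightarrow> pred_val M P (map (\<lambda>a. tval M a e) as)"
| "sat M (Neg \<phi>) e \<longleftrightarrow> \<not> sat M \<phi> e"
| "sat M (Conj \<phi> \<psi>) e \<longleftrightarrow> sat M \<phi> e \<and> sat M \<psi> e"
| "sat M (Disj \<phi> \<psi>) e \<longleftrightarrow> sat M \<phi> e \<or> sat M \<psi> e"
| "sat M (Imp \<phi> \<psi>) e \<longleftrightarrow> (sat M \<phi> e \<longrightarrow> sat M \<psi> e)"
| "sat M (AllMem x t \<phi>) e \<longleftrightarrow>
     (\<forall>a. has_sort x a \<and> hw_mem a (lval M t e) \<longrightarrow> sat M \<phi> (e(x := a)))"
| "sat M (ExMem x t \<phi>) e \<longleftrightarrow>
     (\<exists>a. has_sort x a \<and> hw_mem a (lval M t e) \<and> sat M \<phi> (e(x := a)))"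
| "sat M (AllInit n t \<phi>) e \<longleftrightarrow>
     (\<forall>a. hw_init a (lval M t e) \<longrightarrow> sat M \<phi> (e(LV n := a)))"
| "sat M (ExInit n t \<phi>) e \<longleftrightarrow>
     (\<exists>a. hw_init a (lval M t e) \<and> sat M \<phi> (e(LV n := a)))"

text \<open>
  Equivalence of formulas in all superstructures over structures with domain \<open>'u\<close>.
  HOL cannot quantify over types inside a formula, so the domain is a type parameter; formulas that
  are not equivalent for one choice of \<open>'u\<close> are not equivalent in general.
\<close>

definition equivalent_fm :: "'u itself \<Rightarrow> fm \<Rightarrow> fm \<Rightarrow> bool" where
  "equivalent_fm U \<phi> \<psi> \<longleftrightarrow>
     (\<forall>(M :: 'u struct) e. sorted_assignment e \<longrightarrow> sat M \<phi> e = sat M \<psi> e)"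


section \<open>Formulas as strings\<close>

text \<open>Strings over a fixed finite alphabet; the indices of variables, constants and predicates are
  written in binary.  The fully parenthesised notation is uniquely readable.\<close>

datatype sym =
    Dig0 | Dig1
  | ConstS | UVarS | LVarS | PredS
  | NilS | LAngle | RAngle
  | HeadS | TailS | ConsS | ConcS | RecS | LBrack | RBrack
  | LPar | RPar | Comma
  | EqS | MemS | InitS
  | NegS | ConjS | DisjS | ImpS | AllS | ExS

fun bin :: "nat \<Rightarrow> sym list" where
  "bin n = (if n = 0 then [Dig0] else if n = 1 then [Dig1]
            else bin (n div 2) @ [if even n then Dig0 else Dig1])"

declare bin.simps [simp del]

fun commas :: "sym list list \<Rightarrow> sym list" where
  "commas [] = []"
| "commas [s] = s"
| "commas (s # ss) = s @ Comma # commas ss"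

primrec str_const :: "nat hw \<Rightarrow> sym list" where
  "str_const (Ur c) = ConstS # bin c"
| "str_const (Ls cs) =
     (if cs = [] then [NilS] else LAngle # commas (map str_const cs) @ [RAngle])"

primrec str_var :: "var \<Rightarrow> sym list" where
  "str_var (UV n) = UVarS # bin n"
| "str_var (LV n) = LVarS # bin n"

primrec str_uterm :: "uterm \<Rightarrow> sym list" where
  "str_uterm (UConst c) = ConstS # bin c"
| "str_uterm (UVar n) = str_var (UV n)"

primrec str_lterm :: "lterm \<Rightarrow> sym list" and str_term :: "term \<Rightarrow> sym list" where
  "str_lterm (LConst cs) = str_const (Ls cs)"
| "str_lterm (LVar n) = str_var (LV n)"
| "str_lterm (LHead s) = HeadS # LPar # str_lterm s @ [RPar]"
| "str_lterm (LTail s) = TailS # LPar # str_lterm s @ [RPar]"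
| "str_lterm (LCons s a) = ConsS # LPar # str_lterm s @ Comma # str_term a @ [RPar]"
| "str_lterm (LConc s t) = ConcS # LPar # str_lterm s @ Comma # str_lterm t @ [RPar]"
| "str_lterm (LRec f y z h t) =
     RecS # LBrack # str_lterm f @ Comma # str_var (LV y) @ Comma # str_var (LV z) @ Comma #
     str_lterm h @ Comma # str_lterm t @ [RBrack]"
| "str_term (TU u) = str_uterm u"
| "str_term (TL t) = str_lterm t"

primrec str_fm :: "fm \<Rightarrow> sym list" where
  "str_fm (Eq a b) = LPar # str_term a @ EqS # str_term b @ [RPar]"
| "str_fm (Mem a t) = LPar # str_term a @ MemS # str_lterm t @ [RPar]"
| "str_fm (Init s t) = LPar # str_lterm s @ InitS # str_lterm t @ [RPar]"
| "str_fm (Pred P as) = PredS # bin P @ LPar # commas (map str_term as) @ [RPar]"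
| "str_fm (Neg \<phi>) = NegS # str_fm \<phi>"
| "str_fm (Conj \<phi> \<psi>) = LPar # str_fm \<phi> @ ConjS # str_fm \<psi> @ [RPar]"
| "str_fm (Disj \<phi> \<psi>) = LPar # str_fm \<phi> @ DisjS # str_fm \<psi> @ [RPar]"
| "str_fm (Imp \<phi> \<psi>) = LPar # str_fm \<phi> @ ImpS # str_fm \<psi> @ [RPar]"
| "str_fm (AllMem x t \<phi>) = AllS # str_var x @ MemS # str_lterm t @ str_fm \<phi>"
| "str_fm (ExMem x t \<phi>) = ExS # str_var x @ MemS # str_lterm t @ str_fm \<phi>"
| "str_fm (AllInit n t \<phi>) = AllS # str_var (LV n) @ InitS # str_lterm t @ str_fm \<phi>"
| "str_fm (ExInit n t \<phi>) = ExS # str_var (LV n) @ InitS # str_lterm t @ str_fm \<phi>"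

definition fm_length :: "fm \<Rightarrow> nat" where
  "fm_length \<phi> = length (str_fm \<phi>)"

text \<open>Numbering of the alphabet by the tape symbols \<open>1, \<dots>, num_syms\<close>.\<close>

primrec sym_code :: "sym \<Rightarrow> nat" where
  "sym_code Dig0 = 1" | "sym_code Dig1 = 2"
| "sym_code ConstS = 3" | "sym_code UVarS = 4" | "sym_code LVarS = 5" | "sym_code PredS = 6"
| "sym_code NilS = 7" | "sym_code LAngle = 8" | "sym_code RAngle = 9"
| "sym_code HeadS = 10" | "sym_code TailS = 11" | "sym_code ConsS = 12" | "sym_code ConcS = 13"
| "sym_code RecS = 14" | "sym_code LBrack = 15" | "sym_code RBrack = 16"
| "sym_code LPar = 17" | "sym_code RPar = 18" | "sym_code Comma = 19"
| "sym_code EqS = 20" | "sym_code MemS = 21" | "sym_code InitS = 22"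
| "sym_code NegS = 23" | "sym_code ConjS = 24" | "sym_code DisjS = 25" | "sym_code ImpS = 26"
| "sym_code AllS = 27" | "sym_code ExS = 28"

definition num_syms :: nat where
  "num_syms = 28"

definition true_sentences :: "signature \<Rightarrow> 'u struct \<Rightarrow> nat list set" where
  "true_sentences \<Sigma> M =
     {map sym_code (str_fm \<phi>) |\<phi>. delta0_rec \<Sigma> \<phi> \<and> fv_fm \<phi> = {} \<and>
        (\<forall>e. sorted_assignment e \<longrightarrow> sat M \<phi> e)}"


section \<open>Turing machines and complexity classes\<close>

text \<open>
  Deterministic machines with one two-way infinite tape.  Tape symbols are \<open>0, \<dots>, nsyms - 1\<close> with
  \<open>0\<close> the blank; states are \<open>0, \<dots>, nstates - 1\<close> with initial state \<open>0\<close>.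
\<close>

datatype move = MoveL | Stay | MoveR

record machine =
  nstates :: nat
  nsyms :: nat
  transition :: "nat \<Rightarrow> nat \<Rightarrow> nat \<times> nat \<times> move"
  acc_state :: nat
  rej_state :: nat

definition wf_machine :: "machine \<Rightarrow> bool" where
  "wf_machine A \<longleftrightarrow> 0 < nstates A \<and> 0 < nsyms A \<and>
     acc_state A < nstates A \<and> rej_state A < nstates A \<and> acc_state A \<noteq> rej_state A \<and>
     (\<forall>q < nstates A. \<forall>a < nsyms A. \<forall>q' b d.
        transition A q a = (q', b, d) \<longrightarrow> q' < nstates A \<and> b < nsyms A)"

text \<open>A configuration consists of the state, the tape and the position of the head.\<close>

type_synonym config = "nat \<times> (int \<Rightarrow> nat) \<times> int"

fun shift :: "move \<Rightarrow> int \<Rightarrow> int" where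
  "shift MoveL i = i - 1"
| "shift Stay i = i"
| "shift MoveR i = i + 1"

fun step :: "machine \<Rightarrow> config \<Rightarrow> config" where
  "step A (q, T, i) =
     (if q = acc_state A \<or> q = rej_state A then (q, T, i)
      else case transition A q (T i) of (q', b, d) \<Rightarrow> (q', T(i := b), shift d i))"

definition init_tape :: "nat list \<Rightarrow> int \<Rightarrow> nat" where
  "init_tape w i = (if 0 \<le> i \<and> i < int (length w) then w ! nat i else 0)"

definition run :: "machine \<Rightarrow> nat list \<Rightarrow> nat \<Rightarrow> config" where
  "run A w t = (step A ^^ t) (0, init_tape w, 0)"

text \<open>The output is the string from the head position up to the first blank.\<close>

fun has_output :: "config \<Rightarrow> nat list \<Rightarrow> bool" where
  "has_output (q, T, i) u \<longleftrightarrow>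
     0 \<notin> set u \<and> (\<forall>j < length u. T (i + int j) = u ! j) \<and> T (i + int (length u)) = 0"

text \<open>Words over an alphabet of \<open>m\<close> letters are the lists over \<open>{1..m}\<close>.  Since the halting states
  are fixed points of \<open>step\<close>, being in such a state after \<open>T (length w)\<close> steps means to halt
  within that many steps.\<close>

definition decides_in_time :: "nat \<Rightarrow> nat list set \<Rightarrow> machine \<Rightarrow> (nat \<Rightarrow> nat) \<Rightarrow> bool" where
  "decides_in_time m L A T \<longleftrightarrow> wf_machine A \<and> m < nsyms A \<and> L \<subseteq> lists {1..m} \<and>
     (\<forall>w \<in> lists {1..m}. fst (run A w (T (length w))) =
        (if w \<in> L then acc_state A else rej_state A))"

definition computes_in_time ::
  "nat \<Rightarrow> nat list set \<Rightarrow> (nat list \<Rightarrow> nat list) \<Rightarrow> machine \<Rightarrow> (nat \<Rightarrow> nat) \<Rightarrow> bool" where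
  "computes_in_time m D f A T \<longleftrightarrow> wf_machine A \<and> m < nsyms A \<and> D \<subseteq> lists {1..m} \<and>
     (\<forall>w \<in> D. fst (run A w (T (length w))) = acc_state A \<and>
        has_output (run A w (T (length w))) (f w))"

definition ptime_decidable :: "nat \<Rightarrow> nat list set \<Rightarrow> bool" where
  "ptime_decidable m L \<longleftrightarrow> (\<exists>A (p :: nat poly). decides_in_time m L A (poly p))"

definition ptime_computable :: "nat \<Rightarrow> nat list set \<Rightarrow> (nat list \<Rightarrow> nat list) \<Rightarrow> bool" where
  "ptime_computable m D f \<longleftrightarrow> (\<exists>A (p :: nat poly). computes_in_time m D f A (poly p))"

text \<open>Iterated exponential, with \<open>exp_iter 1 n = 2 ^ n\<close>.\<close>

fun exp_iter :: "nat \<Rightarrow> nat \<Rightarrow> nat" where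
  "exp_iter 0 n = n"
| "exp_iter (Suc k) n = 2 ^ exp_iter k n"

definition kEXPTIME :: "nat \<Rightarrow> nat \<Rightarrow> nat list set set" where
  "kEXPTIME k m =
     {L. \<exists>A (p :: nat poly). decides_in_time m L A (\<lambda>n. exp_iter k (poly p n))}"

definition elementary :: "nat \<Rightarrow> nat list set \<Rightarrow> bool" where
  "elementary m L \<longleftrightarrow> (\<exists>k\<ge>1. L \<in> kEXPTIME k m)"

definition ptime_reducible :: "nat \<Rightarrow> nat list set \<Rightarrow> nat \<Rightarrow> nat list set \<Rightarrow> bool" where
  "ptime_reducible m L n B \<longleftrightarrow>
     (\<exists>f. ptime_computable m (lists {1..m}) f \<and>
        (\<forall>w \<in> lists {1..m}. f w \<in> lists {1..n} \<and> (w \<in> L \<longleftrightarrow> f w \<in> B)))"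

definition kEXPTIME_hard :: "nat \<Rightarrow> nat \<Rightarrow> nat list set \<Rightarrow> bool" where
  "kEXPTIME_hard k n B \<longleftrightarrow> (\<forall>m. \<forall>L \<in> kEXPTIME k m. ptime_reducible m L n B)"


section \<open>Polynomial-time computable representations\<close>

text \<open>Tuples of words over \<open>{1..m}\<close> are words over \<open>{1..Suc m}\<close>.\<close>

definition tuple :: "nat \<Rightarrow> nat list list \<Rightarrow> nat list" where
  "tuple m ws = concat (map (\<lambda>w. w @ [Suc m]) ws)"

text \<open>In the following, \<open>D\<close> is a set of names over \<open>{1..m}\<close> and \<open>\<nu>\<close> maps a name to the named
  element.\<close>

definition ptime_relation ::
  "nat \<Rightarrow> nat list set \<Rightarrow> (nat list \<Rightarrow> 'u hw) \<Rightarrow> nat \<Rightarrow> ('u hw list \<Rightarrow> bool) \<Rightarrow> bool" where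
  "ptime_relation m D \<nu> n R \<longleftrightarrow>
     ptime_decidable (Suc m) {tuple m ws |ws. ws \<in> lists D \<and> length ws = n \<and> R (map \<nu> ws)}"

definition ptime_operation ::
  "nat \<Rightarrow> nat list set \<Rightarrow> (nat list \<Rightarrow> 'u hw) \<Rightarrow> nat \<Rightarrow> ('u hw list \<Rightarrow> 'u hw) \<Rightarrow> bool" where
  "ptime_operation m D \<nu> n F \<longleftrightarrow>
     (\<exists>f. ptime_computable (Suc m) {tuple m ws |ws. ws \<in> lists D \<and> length ws = n} f \<and>
        (\<forall>ws \<in> lists D. length ws = n \<longrightarrow>
           f (tuple m ws) \<in> D \<and> \<nu> (f (tuple m ws)) = F (map \<nu> ws)))"

text \<open>A name of the value is computed from the string of a variable-free standard list term.\<close>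

definition ptime_term_values ::
  "signature \<Rightarrow> 'u struct \<Rightarrow> nat list set \<Rightarrow> (nat list \<Rightarrow> 'u hw) \<Rightarrow> bool" where
  "ptime_term_values \<Sigma> M D \<nu> \<longleftrightarrow>
     (let C = {t. lterm_ok \<Sigma> t \<and> standard_lterm t \<and> fv_lterm t = {}} in
      \<exists>f. ptime_computable num_syms ((\<lambda>t. map sym_code (str_lterm t)) ` C) f \<and>
        (\<forall>t \<in> C. \<forall>e. f (map sym_code (str_lterm t)) \<in> D \<and>
           \<nu> (f (map sym_code (str_lterm t))) = lval M t e))"

definition ptime_representation ::
  "signature \<Rightarrow> 'u struct \<Rightarrow> nat \<Rightarrow> nat list set \<Rightarrow> (nat list \<Rightarrow> 'u hw) \<Rightarrow> bool" where
  "ptime_representation \<Sigma> M m D \<nu> \<longleftrightarrow>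
     ptime_decidable m D \<and> \<nu> ` D = UNIV \<and>
     ptime_relation m D \<nu> 1 (\<lambda>xs. is_ur (xs ! 0)) \<and>
     ptime_relation m D \<nu> 2 (\<lambda>xs. xs ! 0 = xs ! 1) \<and>
     ptime_relation m D \<nu> 2 (\<lambda>xs. hw_mem (xs ! 0) (xs ! 1)) \<and>
     ptime_relation m D \<nu> 2 (\<lambda>xs. hw_init (xs ! 0) (xs ! 1)) \<and>
     (\<forall>P \<in> pred_syms \<Sigma>. ptime_relation m D \<nu> (arity \<Sigma> P) (pred_val M P)) \<and>
     ptime_operation m D \<nu> 1 (\<lambda>xs. hw_head (xs ! 0)) \<and>
     ptime_operation m D \<nu> 1 (\<lambda>xs. hw_tail (xs ! 0)) \<and>
     ptime_operation m D \<nu> 2 (\<lambda>xs. hw_cons (xs ! 0) (xs ! 1)) \<and>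
     ptime_operation m D \<nu> 2 (\<lambda>xs. hw_conc (xs ! 0) (xs ! 1)) \<and>
     ptime_term_values \<Sigma> M D \<nu>"

end

theory Submission
  imports Defs
begin

text \<open>
  Recursive terms can tabulate a transition function, iterate it, and double a list as often as
  another list is long. So for every machine \<open>A\<close>, every \<open>k\<close> and every polynomial \<open>p\<close> there is a fixed
  sentence with one hole for a closed term \<open>W\<close> that says that \<open>A\<close> accepts the word denoted by \<open>W\<close>
  within \<open>exp\<^sub>k(p(n))\<close> steps.

  Hardness: if \<open>W\<close> is the constant list that spells an input \<open>w\<close>, the sentence arises from \<open>w\<close> by a
  letter-wise substitution, framed by two fixed strings, and this is computable in polynomial time.

  Non-elementarity: no time hierarchy theorem is needed. If \<open>A\<close> decided the true sentences in time
  \<open>exp\<^sub>k(p(n))\<close>, there would be a sentence whose \<open>W\<close> denotes the sentence itself and which says that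
  \<open>A\<close> does not accept it.

  Succinctness: a formula of length \<open>O(n)\<close> with a recursive term defines the \<open>2\<^sup>n\<close>-fold nesting of the
  empty list. A standard formula of length \<open>l\<close> inspects its free variables only to depth \<open>l\<close>, and its
  bound variables range over small objects; so it cannot tell nestings of depth much larger than \<open>l\<close>
  from each other.
\<close>

section \<open>Unique readability\<close>

text \<open>\<open>true_sentences\<close> is a set of strings: membership of a string says something
  about one given sentence only because no other formula has the same string. Unique readability
  therefore comes first.

  Lists are accessed at their last element, so words, stacks and tables are stored in reverse. The
  head of the empty list is nil, which is also the unary 0 and hence the blank: an exhausted stack
  reads as blank tape without a case distinction. No urelement constant is ever used, so the
  sentences exist over every signature and mean the same in every structure.

  For succinctness the obstacle is that terms can build new nestings. The two values of the free
  variable are related by \<open>deepen k\<close>, which adds one level at \<open>nest k\<close>;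
  applying list functions is safe where \<open>nest k\<close> is neither argument nor result. So
  \<open>k\<close> is put into a gap: what constants and closed bounds provide stays below it, and
  every nesting visible in \<open>nest (2 ^ n)\<close> within the reach of the formula stays above
  it.\<close>

definition nodig :: "sym list \<Rightarrow> bool" where
  "nodig u \<longleftrightarrow> u = [] \<or> hd u \<notin> {Dig0, Dig1}"

lemma nodig_simps [simp]: "nodig []" "nodig (s # u) \<longleftrightarrow> s \<noteq> Dig0 \<and> s \<noteq> Dig1"
  by (auto simp: nodig_def)

lemma set_bin: "set (bin n) \<subseteq> {Dig0, Dig1}"
proof (induction n rule: bin.induct)
  case (1 n)
  then show ?case
    by (subst bin.simps) auto
qed

lemma bin_value: "foldl (\<lambda>v d. 2 * v + (if d = Dig1 then 1 else 0)) 0 (bin n) = (n :: nat)"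
proof (induction n rule: bin.induct)
  case (1 n)
  then show ?case
    by (subst bin.simps) auto
qed

text \<open>Binary indices carry no end marker, so the split after one is determined only if no
  digit follows. This is the origin of the \<open>nodig\<close> conditions in the parsing lemmas;
  injectivity of \<open>bin\<close> comes from Horner evaluation.\<close>

lemma bin_parse:
  assumes "bin n @ u = bin k @ v" "nodig u" "nodig v"
  shows "n = k \<and> u = v"
proof -
  have *: "takeWhile (\<lambda>s. s \<in> {Dig0, Dig1}) (bin n @ u) = bin n" if "nodig u" for n u
  proof -
    have "takeWhile (\<lambda>s. s \<in> {Dig0, Dig1}) u = []"
      using that by (cases u) auto
    moreover have "takeWhile (\<lambda>s. s \<in> {Dig0, Dig1}) (bin n @ u) =
        bin n @ takeWhile (\<lambda>s. s \<in> {Dig0, Dig1}) u"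
      by (rule takeWhile_append2) (use set_bin[of n] in blast)
    ultimately show ?thesis
      by simp
  qed
  have "bin n = bin k"
    using *[of u n] *[of v k] assms by simp
  moreover from this have "n = k"
    by (metis bin_value)
  ultimately show ?thesis
    using assms(1) by simp
qed

text \<open>\<open>E\<close> is the closing bracket. No item starts with it, so it reveals the end
  of an empty list, and it differs from \<open>Comma\<close>, so it reveals the end of any other.
  Parsing is assumed only for members of \<open>xs\<close>, which is what a structural induction on
  nested lists can supply.\<close>

lemma commas_parse:
  assumes "\<And>x y u v. x \<in> set xs \<Longrightarrow> f x @ u = f y @ v \<Longrightarrow> nodig u \<Longrightarrow> nodig v \<Longrightarrow> x = y \<and> u = v"
    and "\<And>y. \<exists>s r. f y = s # r \<and> s \<noteq> E"
    and "E \<noteq> Comma" "nodig [E]"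
    and "commas (map f xs) @ E # u = commas (map f ys) @ E # v"
  shows "xs = ys \<and> u = v"
  using assms
proof (induction xs arbitrary: ys)
  case Nil
  show ?case
  proof (cases ys)
    case (Cons y ys')
    then obtain r where "E # u = f y @ r"
      using Nil.prems(5) by (cases ys') auto
    then show ?thesis
      using Nil.prems(2)[of y] by auto
  qed (use Nil in simp)
next
  case (Cons x xs)
  obtain y ys' where ys: "ys = y # ys'"
  proof (cases ys)
    case Nil
    obtain r where "f x @ r = E # v"
      using Cons.prems(5) Nil by (cases xs) auto
    then show ?thesis
      using Cons.prems(2)[of x] by auto
  qed
  have expand: "commas (map f (z # zs)) @ E # w =
      f z @ (if zs = [] then E # w else Comma # commas (map f zs) @ E # w)" for z zs w
    by (cases zs) simp_all
  have "x = y \<and> (if xs = [] then E # u else Comma # commas (map f xs) @ E # u) =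
      (if ys' = [] then E # v else Comma # commas (map f ys') @ E # v)"
    using Cons.prems(3,4) Cons.prems(5)[unfolded ys expand] by (intro Cons.prems(1)) simp_all
  moreover from this Cons.prems(3) have "xs = ys' \<and> u = v"
  proof (cases "xs = [] \<or> ys' = []")
    case False
    show ?thesis
    proof (rule Cons.IH)
      show "x = y \<and> u = v"
        if "x \<in> set xs" "f x @ u = f y @ v" "nodig u" "nodig v" for x y u v
        using that by (intro Cons.prems(1)) simp_all
    qed (use Cons.prems(2,3,4) calculation False in simp_all)
  qed (auto split: if_splits)
  ultimately show ?case
    using ys by simp
qed

lemma str_const_start: "\<exists>s r. str_const c = s # r \<and> s \<in> {ConstS, NilS, LAngle}"
  by (cases c) auto

lemma str_const_parse:
  "str_const a @ u = str_const b @ v \<Longrightarrow> nodig u \<Longrightarrow> nodig v \<Longrightarrow> a = b \<and> u = v"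
proof (induction a arbitrary: b u v)
  case (Ur c)
  then show ?case
    by (cases b) (auto split: if_splits dest: bin_parse)
next
  case (Ls cs)
  show ?case
  proof (cases b)
    case (Ur d)
    then show ?thesis using Ls.prems by (auto split: if_splits)
  next
    case b: (Ls ds)
    show ?thesis
    proof (cases "cs = [] \<or> ds = []")
      case True
      then show ?thesis using Ls.prems b by (auto split: if_splits)
    next
      case False
      have "cs = ds \<and> u = v"
      proof (rule commas_parse[where f = str_const and E = RAngle])
        show "\<exists>s r. str_const y = s # r \<and> s \<noteq> RAngle" for y
          using str_const_start[of y] by auto
        show "x = y \<and> u' = v'"
          if "x \<in> set cs" "str_const x @ u' = str_const y @ v'" "nodig u'" "nodig v'" for x y u' v'
          using Ls.IH that by blast
        show "commas (map str_const cs) @ RAngle # u = commas (map str_const ds) @ RAngle # v"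
          using Ls.prems(1) b False by simp
      qed simp_all
      then show ?thesis using b by simp
    qed
  qed
qed

text \<open>The remainders \<open>u\<close> and \<open>v\<close> are arbitrary so that the induction
  hypothesis applies to a component followed by the rest of the string.\<close>

lemma str_term_parse:
  "str_lterm s @ u = str_lterm s' @ v \<Longrightarrow> nodig u \<Longrightarrow> nodig v \<Longrightarrow> s = s' \<and> u = v"
  "str_term a @ u = str_term a' @ v \<Longrightarrow> nodig u \<Longrightarrow> nodig v \<Longrightarrow> a = a' \<and> u = v"
proof (induction s and a arbitrary: s' u v and a' u v)
  case (LConst cs)
  show ?case
  proof (cases s')
    case (LConst ds)
    then show ?thesis
      using LConst.prems str_const_parse[of "Ls cs" u "Ls ds" v] by simp
  qed (use LConst.prems in \<open>simp_all split: if_splits\<close>)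
next
  case (LVar n)
  show ?case
  proof (cases s')
    case s': (LVar k)
    then show ?thesis
      using LVar.prems bin_parse[of n u k v] by simp
  qed (use LVar.prems in \<open>simp_all split: if_splits\<close>)
next
  case (LHead s)
  show ?case
  proof (cases s')
    case s': (LHead s1)
    then show ?thesis
      using LHead.prems LHead.IH[of "RPar # u" s1 "RPar # v"] by simp
  qed (use LHead.prems in \<open>simp_all split: if_splits\<close>)
next
  case (LTail s)
  show ?case
  proof (cases s')
    case s': (LTail s1)
    then show ?thesis
      using LTail.prems LTail.IH[of "RPar # u" s1 "RPar # v"] by simp
  qed (use LTail.prems in \<open>simp_all split: if_splits\<close>)
next
  case (LCons s a)
  show ?case
  proof (cases s')
    case s': (LCons s1 a1)
    have "s = s1 \<and> Comma # str_term a @ RPar # u = Comma # str_term a1 @ RPar # v"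
      using LCons.prems s' by (intro LCons.IH(1)) simp_all
    moreover from this have "a = a1 \<and> RPar # u = RPar # v"
      by (intro LCons.IH(2)) simp_all
    ultimately show ?thesis
      using s' by simp
  qed (use LCons.prems in \<open>simp_all split: if_splits\<close>)
next
  case (LConc s t)
  show ?case
  proof (cases s')
    case s': (LConc s1 t1)
    have "s = s1 \<and> Comma # str_lterm t @ RPar # u = Comma # str_lterm t1 @ RPar # v"
      using LConc.prems s' by (intro LConc.IH(1)) simp_all
    moreover from this have "t = t1 \<and> RPar # u = RPar # v"
      by (intro LConc.IH(2)) simp_all
    ultimately show ?thesis
      using s' by simp
  qed (use LConc.prems in \<open>simp_all split: if_splits\<close>)
next
  case (LRec f y z h t)
  show ?case
  proof (cases s')
    case s': (LRec f' y' z' h' t')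
    have "f = f' \<and> Comma # LVarS # bin y @ Comma # LVarS # bin z @ Comma # str_lterm h @ Comma #
        str_lterm t @ RBrack # u =
      Comma # LVarS # bin y' @ Comma # LVarS # bin z' @ Comma # str_lterm h' @ Comma #
        str_lterm t' @ RBrack # v"
      using LRec.prems s' by (intro LRec.IH(1)) simp_all
    moreover from this have "y = y' \<and> Comma # LVarS # bin z @ Comma # str_lterm h @ Comma #
        str_lterm t @ RBrack # u =
      Comma # LVarS # bin z' @ Comma # str_lterm h' @ Comma # str_lterm t' @ RBrack # v"
      by (intro bin_parse) simp_all
    moreover from this have "z = z' \<and> Comma # str_lterm h @ Comma # str_lterm t @ RBrack # u =
      Comma # str_lterm h' @ Comma # str_lterm t' @ RBrack # v"
      by (intro bin_parse) simp_all
    moreover from this have "h = h' \<and> Comma # str_lterm t @ RBrack # u =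
      Comma # str_lterm t' @ RBrack # v"
      by (intro LRec.IH(2)) simp_all
    moreover from this have "t = t' \<and> RBrack # u = RBrack # v"
      by (intro LRec.IH(3)) simp_all
    ultimately show ?thesis
      using s' by simp
  qed (use LRec.prems in \<open>auto split: if_splits\<close>)
next
  case (TU x)
  show ?case
  proof (cases a')
    case (TU x')
    then show ?thesis
      using \<open>str_term (TU x) @ u = _\<close> TU.prems
      by (cases x; cases x') (auto dest: bin_parse)
  next
    case (TL t)
    then show ?thesis
      using \<open>str_term (TU x) @ u = _\<close> by (cases x; cases t) (auto split: if_splits)
  qed
next
  case (TL t)
  show ?case
  proof (cases a')
    case (TU x)
    then show ?thesis
      using \<open>str_term (TL t) @ u = _\<close> by (cases x; cases t) (auto split: if_splits)
  next
    case a': (TL t')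
    then show ?thesis
      using TL by auto
  qed
qed

lemma str_term_start:
  "\<exists>s r. str_term a = s # r \<and>
     s \<in> {ConstS, UVarS, LVarS, NilS, LAngle, HeadS, TailS, ConsS, ConcS, RecS}"
proof (cases a)
  case (TU x)
  then show ?thesis by (cases x) auto
next
  case (TL t)
  then show ?thesis by (cases t) auto
qed

lemma str_fm_start: "\<exists>s r. str_fm \<phi> = s # r \<and> s \<in> {LPar, PredS, NegS, AllS, ExS}"
  by (cases \<phi>) auto

text \<open>\<open>LPar\<close> opens atomic as well as compound formulas. The next symbol decides,
  since terms and formulas start with disjoint sets of symbols.\<close>

lemma str_term_neq_fm [simp]:
  "str_term a @ u \<noteq> str_fm \<phi> @ v" "str_fm \<phi> @ v \<noteq> str_term a @ u"
  using str_term_start[of a] str_fm_start[of \<phi>] by auto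

lemma nodig_str_fm [simp]: "nodig (str_fm \<phi> @ u)"
  using str_fm_start[of \<phi>] by auto

lemma str_var_parse:
  "str_var x @ u = str_var y @ v \<Longrightarrow> nodig u \<Longrightarrow> nodig v \<Longrightarrow> x = y \<and> u = v"
  by (cases x; cases y) (auto dest: bin_parse)

lemma str_lterm_neq_fm [simp]:
  "str_lterm a @ u \<noteq> str_fm \<phi> @ v" "str_fm \<phi> @ v \<noteq> str_lterm a @ u"
  using str_term_neq_fm[where a = "TL a"] by simp_all

text \<open>Lifting list terms by \<open>TL\<close> lets one lemma serve all three kinds of atomic
  formulas with an infix symbol, including the comparison of different kinds.\<close>

lemma infix_parse:
  assumes "str_term a @ R # str_term b @ RPar # u = str_term a' @ R' # str_term b' @ RPar # v"
    and "R \<in> {EqS, MemS, InitS}" "R' \<in> {EqS, MemS, InitS}"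
  shows "a = a' \<and> R = R' \<and> b = b' \<and> u = v"
proof -
  have "a = a'" and e: "R # str_term b @ RPar # u = R' # str_term b' @ RPar # v"
    using str_term_parse(2)[OF assms(1)] assms(2,3) by fastforce+
  moreover have "b = b' \<and> RPar # u = RPar # v"
    using e by (intro str_term_parse(2)) simp_all
  ultimately show ?thesis
    by simp
qed

lemma quant_parse:
  assumes "str_var x @ R # str_lterm t @ str_fm \<phi> @ u = str_var x' @ R' # str_lterm t' @ str_fm \<phi>' @ v"
    and "R \<in> {MemS, InitS}" "R' \<in> {MemS, InitS}"
  shows "x = x' \<and> R = R' \<and> t = t' \<and> str_fm \<phi> @ u = str_fm \<phi>' @ v"
proof -
  have "x = x'" and e: "R # str_lterm t @ str_fm \<phi> @ u = R' # str_lterm t' @ str_fm \<phi>' @ v"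
    using str_var_parse[OF assms(1)] assms(2,3) by fastforce+
  moreover have "t = t' \<and> str_fm \<phi> @ u = str_fm \<phi>' @ v"
    using e by (intro str_term_parse(1)) simp_all
  ultimately show ?thesis
    by simp
qed

text \<open>The remainders are unrestricted because every formula string ends in
  \<open>RPar\<close>, never in an open binary index.\<close>

lemma str_fm_parse: "str_fm \<phi> @ u = str_fm \<phi>' @ v \<Longrightarrow> \<phi> = \<phi>' \<and> u = v"
proof (induction \<phi> arbitrary: \<phi>' u v)
  case (Eq a b)
  show ?case
  proof (cases \<phi>')
    case (Eq a' b')
    with Eq.prems infix_parse[of a EqS b u a' EqS b' v] show ?thesis by simp
  next
    case (Mem a' t)
    with Eq.prems infix_parse[of a EqS b u a' MemS "TL t" v] show ?thesis by simp
  next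
    case (Init s t)
    with Eq.prems infix_parse[of a EqS b u "TL s" InitS "TL t" v] show ?thesis by simp
  qed (use Eq.prems in simp_all)
next
  case (Mem a t)
  show ?case
  proof (cases \<phi>')
    case (Eq a' b')
    with Mem.prems infix_parse[of a MemS "TL t" u a' EqS b' v] show ?thesis by simp
  next
    case (Mem a' t')
    with Mem.prems infix_parse[of a MemS "TL t" u a' MemS "TL t'" v] show ?thesis by simp
  next
    case (Init s' t')
    with Mem.prems infix_parse[of a MemS "TL t" u "TL s'" InitS "TL t'" v] show ?thesis by simp
  qed (use Mem.prems in simp_all)
next
  case (Init s t)
  show ?case
  proof (cases \<phi>')
    case (Eq a' b')
    with Init.prems infix_parse[of "TL s" InitS "TL t" u a' EqS b' v] show ?thesis by simp
  next
    case (Mem a' t')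
    with Init.prems infix_parse[of "TL s" InitS "TL t" u a' MemS "TL t'" v] show ?thesis by simp
  next
    case (Init s' t')
    with Init.prems infix_parse[of "TL s" InitS "TL t" u "TL s'" InitS "TL t'" v] show ?thesis by simp
  qed (use Init.prems in simp_all)
next
  case (Pred P as)
  show ?case
  proof (cases \<phi>')
    case (Pred P' as')
    then have "bin P @ LPar # commas (map str_term as) @ RPar # u =
        bin P' @ LPar # commas (map str_term as') @ RPar # v"
      using Pred.prems by simp
    then have "P = P' \<and> LPar # commas (map str_term as) @ RPar # u =
        LPar # commas (map str_term as') @ RPar # v"
      by (rule bin_parse) simp_all
    moreover have "as = as' \<and> u = v"
    proof (rule commas_parse[where f = str_term and E = RPar])
      show "x = y \<and> u' = v'" if "str_term x @ u' = str_term y @ v'" "nodig u'" "nodig v'" for x y u' v'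
        using that by (rule str_term_parse(2))
      show "\<exists>s r. str_term y = s # r \<and> s \<noteq> RPar" for y
        using str_term_start[of y] by auto
    qed (use calculation in simp_all)
    ultimately show ?thesis
      using Pred by simp
  qed (use Pred.prems in simp_all)
next
  case (Neg \<phi>)
  show ?case
    by (cases \<phi>') (use Neg in auto)
next
  case (Conj \<phi> \<psi>)
  show ?case
  proof (cases \<phi>')
    case (Conj \<phi>1 \<psi>1)
    then have "\<phi> = \<phi>1 \<and> ConjS # str_fm \<psi> @ RPar # u = ConjS # str_fm \<psi>1 @ RPar # v"
      using Conj.prems by (intro Conj.IH(1)) simp
    moreover from this have "\<psi> = \<psi>1 \<and> RPar # u = RPar # v"
      by (intro Conj.IH(2)) simp
    ultimately show ?thesis
      using Conj by simp
  next
    case (Disj \<phi>1 \<psi>1)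
    then show ?thesis
      using Conj.prems Conj.IH(1)[of "ConjS # str_fm \<psi> @ RPar # u" \<phi>1 "DisjS # str_fm \<psi>1 @ RPar # v"]
      by simp
  next
    case (Imp \<phi>1 \<psi>1)
    then show ?thesis
      using Conj.prems Conj.IH(1)[of "ConjS # str_fm \<psi> @ RPar # u" \<phi>1 "ImpS # str_fm \<psi>1 @ RPar # v"]
      by simp
  qed (use Conj.prems in simp_all)
next
  case (Disj \<phi> \<psi>)
  show ?case
  proof (cases \<phi>')
    case (Disj \<phi>1 \<psi>1)
    then have "\<phi> = \<phi>1 \<and> DisjS # str_fm \<psi> @ RPar # u = DisjS # str_fm \<psi>1 @ RPar # v"
      using Disj.prems by (intro Disj.IH(1)) simp
    moreover from this have "\<psi> = \<psi>1 \<and> RPar # u = RPar # v"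
      by (intro Disj.IH(2)) simp
    ultimately show ?thesis
      using Disj by simp
  next
    case (Conj \<phi>1 \<psi>1)
    then show ?thesis
      using Disj.prems Disj.IH(1)[of "DisjS # str_fm \<psi> @ RPar # u" \<phi>1 "ConjS # str_fm \<psi>1 @ RPar # v"]
      by simp
  next
    case (Imp \<phi>1 \<psi>1)
    then show ?thesis
      using Disj.prems Disj.IH(1)[of "DisjS # str_fm \<psi> @ RPar # u" \<phi>1 "ImpS # str_fm \<psi>1 @ RPar # v"]
      by simp
  qed (use Disj.prems in simp_all)
next
  case (Imp \<phi> \<psi>)
  show ?case
  proof (cases \<phi>')
    case (Imp \<phi>1 \<psi>1)
    then have "\<phi> = \<phi>1 \<and> ImpS # str_fm \<psi> @ RPar # u = ImpS # str_fm \<psi>1 @ RPar # v"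
      using Imp.prems by (intro Imp.IH(1)) simp
    moreover from this have "\<psi> = \<psi>1 \<and> RPar # u = RPar # v"
      by (intro Imp.IH(2)) simp
    ultimately show ?thesis
      using Imp by simp
  next
    case (Conj \<phi>1 \<psi>1)
    then show ?thesis
      using Imp.prems Imp.IH(1)[of "ImpS # str_fm \<psi> @ RPar # u" \<phi>1 "ConjS # str_fm \<psi>1 @ RPar # v"]
      by simp
  next
    case (Disj \<phi>1 \<psi>1)
    then show ?thesis
      using Imp.prems Imp.IH(1)[of "ImpS # str_fm \<psi> @ RPar # u" \<phi>1 "DisjS # str_fm \<psi>1 @ RPar # v"]
      by simp
  qed (use Imp.prems in simp_all)
next
  case (AllMem x t \<phi>)
  show ?case
  proof (cases \<phi>')
    case (AllMem x' t' \<phi>1)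
    with AllMem.prems AllMem.IH[of u \<phi>1 v] quant_parse[of x MemS t \<phi> u x' MemS t' \<phi>1 v]
    show ?thesis by simp
  next
    case (AllInit n t' \<phi>1)
    with AllMem.prems quant_parse[of x MemS t \<phi> u "LV n" InitS t' \<phi>1 v] show ?thesis by simp
  qed (use AllMem.prems in simp_all)
next
  case (ExMem x t \<phi>)
  show ?case
  proof (cases \<phi>')
    case (ExMem x' t' \<phi>1)
    with ExMem.prems ExMem.IH[of u \<phi>1 v] quant_parse[of x MemS t \<phi> u x' MemS t' \<phi>1 v]
    show ?thesis by simp
  next
    case (ExInit n t' \<phi>1)
    with ExMem.prems quant_parse[of x MemS t \<phi> u "LV n" InitS t' \<phi>1 v] show ?thesis by simp
  qed (use ExMem.prems in simp_all)
next
  case (AllInit n t \<phi>)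
  show ?case
  proof (cases \<phi>')
    case (AllMem x' t' \<phi>1)
    with AllInit.prems quant_parse[of "LV n" InitS t \<phi> u x' MemS t' \<phi>1 v] show ?thesis by simp
  next
    case (AllInit n' t' \<phi>1)
    with AllInit.prems AllInit.IH[of u \<phi>1 v] quant_parse[of "LV n" InitS t \<phi> u "LV n'" InitS t' \<phi>1 v]
    show ?thesis by simp
  qed (use AllInit.prems in simp_all)
next
  case (ExInit n t \<phi>)
  show ?case
  proof (cases \<phi>')
    case (ExMem x' t' \<phi>1)
    with ExInit.prems quant_parse[of "LV n" InitS t \<phi> u x' MemS t' \<phi>1 v] show ?thesis by simp
  next
    case (ExInit n' t' \<phi>1)
    with ExInit.prems ExInit.IH[of u \<phi>1 v] quant_parse[of "LV n" InitS t \<phi> u "LV n'" InitS t' \<phi>1 v]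
    show ?thesis by simp
  qed (use ExInit.prems in simp_all)
qed

theorem str_fm_inject: "str_fm \<phi> = str_fm \<psi> \<longleftrightarrow> \<phi> = \<psi>"
  using str_fm_parse[of \<phi> "[]" \<psi> "[]"] by auto

lemma sym_code_inject: "sym_code s = sym_code s' \<longleftrightarrow> s = s'"
  by (cases s; cases s') simp_all

lemma sym_code_range: "sym_code s \<in> {1..num_syms}"
  by (cases s) (simp_all add: num_syms_def)

lemma map_sym_code_inject: "map sym_code xs = map sym_code ys \<longleftrightarrow> xs = ys"
  by (rule inj_map_eq_map[OF injI]) (simp add: sym_code_inject)

section \<open>Simulating a machine by recursive terms\<close>

text \<open>Numbers are represented in unary, words as lists of such numbers.\<close>

definition un :: "nat \<Rightarrow> 'a hw" where
  "un n = Ls (replicate n (Ls []))"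

lemma map_hw_un [simp]: "map_hw f (un n) = un n"
  by (simp add: un_def)

lemma set_hw_un [simp]: "set_hw (un n) = {}"
  by (auto simp: un_def)

lemma elems_un [simp]: "elems (un n) = replicate n (Ls [])"
  by (simp add: un_def)

lemma un_0 [simp]: "un 0 = Ls []"
  by (simp add: un_def)

lemma un_inject: "un n = un k \<longleftrightarrow> n = k"
  by (auto simp: un_def dest: arg_cong[of _ _ length])

lemma hw_head_Ls: "hw_head (Ls xs) = (if xs = [] then Ls [] else last xs)"
  by (simp add: hw_head_def)

lemma hw_tail_Ls: "hw_tail (Ls xs) = Ls (butlast xs)"
  by (simp add: hw_tail_def)

text \<open>
  \<open>drop_term s t\<close> removes as many elements from the end of \<open>s\<close> as \<open>t\<close> has; so \<open>nth_term\<close> looks up an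
  entry of a table that is stored in reverse, at an index given in unary.
\<close>

definition drop_term :: "lterm \<Rightarrow> lterm \<Rightarrow> lterm" where
  "drop_term s t = LRec s 3 4 (LTail (LVar 3)) t"

definition nth_term :: "lterm \<Rightarrow> lterm \<Rightarrow> lterm" where
  "nth_term s t = LHead (drop_term s t)"

definition rev_term :: "lterm \<Rightarrow> lterm" where
  "rev_term t = LRec (LConst []) 3 4 (LConc (LCons (LConst []) (TL (LVar 4))) (LVar 3)) t"

lemma foldl_hw_tail: "foldl (\<lambda>g b. hw_tail g) (Ls (rev xs)) bs = Ls (rev (drop (length bs) xs))"
proof (induction bs arbitrary: xs)
  case (Cons b bs)
  have "hw_tail (Ls (rev xs)) = Ls (rev (tl xs))"
    by (cases xs) (simp_all add: hw_tail_Ls butlast_append)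
  then show ?case
    using Cons[of "tl xs"] by (simp add: drop_Suc)
qed simp

lemma lval_drop_term:
  assumes "lval M s e = Ls (rev xs)"
  shows "lval M (drop_term s t) e = Ls (rev (drop (length (elems (lval M t e))) xs))"
  by (simp add: drop_term_def assms foldl_hw_tail)

lemma lval_nth_term:
  assumes "lval M s e = Ls (rev xs)" "lval M t e = un i" "i < length xs"
  shows "lval M (nth_term s t) e = xs ! i"
  using assms(3) by (simp add: nth_term_def lval_drop_term[OF assms(1)] assms(2) hw_head_Ls
      last_rev hd_drop_conv_nth)

lemma lval_rev_term: "lval M (rev_term t) e = Ls (rev (elems (lval M t e)))"
proof -
  have "foldl (\<lambda>g b. hw_conc (hw_cons (Ls []) b) g) (Ls ys) bs = Ls (rev bs @ ys)" for ys bs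
    by (induction bs arbitrary: ys) (simp_all add: hw_conc_def hw_cons_def)
  from this[of "[]"] show ?thesis
    by (simp add: rev_term_def)
qed

lemma term_syntax [simp]:
  "lterm_ok \<Sigma> (drop_term s t) \<longleftrightarrow> lterm_ok \<Sigma> s \<and> lterm_ok \<Sigma> t"
  "lterm_ok \<Sigma> (nth_term s t) \<longleftrightarrow> lterm_ok \<Sigma> s \<and> lterm_ok \<Sigma> t"
  "lterm_ok \<Sigma> (rev_term t) \<longleftrightarrow> lterm_ok \<Sigma> t"
  "fv_lterm (drop_term s t) = fv_lterm s \<union> fv_lterm t"
  "fv_lterm (nth_term s t) = fv_lterm s \<union> fv_lterm t"
  "fv_lterm (rev_term t) = fv_lterm t"
  by (auto simp: drop_term_def nth_term_def rev_term_def)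

section \<open>The tape as a pair of stacks\<close>

definition hd0 :: "nat list \<Rightarrow> nat" where
  "hd0 xs = (if xs = [] then 0 else hd xs)"

definition nth0 :: "nat list \<Rightarrow> nat \<Rightarrow> nat" where
  "nth0 xs j = (if j < length xs then xs ! j else 0)"

text \<open>
  The tape is split at the head into two stacks: \<open>r\<close> starts with the scanned cell and \<open>l\<close> with the
  cell to its left.  Beyond the end of a stack the tape is blank.
\<close>

fun moved :: "move \<Rightarrow> nat \<Rightarrow> nat list \<Rightarrow> nat list \<Rightarrow> nat list \<times> nat list" where
  "moved MoveL b l r = (tl l, hd0 l # b # tl r)"
| "moved Stay b l r = (l, b # tl r)"
| "moved MoveR b l r = (b # l, tl r)"

text \<open>Halting states become self-loops that rewrite the scanned symbol, so the term for one
  step needs no test for halting: the loop is just another table entry.\<close>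

definition total_trans :: "machine \<Rightarrow> nat \<Rightarrow> nat \<Rightarrow> nat \<times> nat \<times> move" where
  "total_trans A q a = (if q = acc_state A \<or> q = rej_state A then (q, a, Stay) else transition A q a)"

fun stack_step :: "machine \<Rightarrow> nat \<times> nat list \<times> nat list \<Rightarrow> nat \<times> nat list \<times> nat list" where
  "stack_step A (q, l, r) = (case total_trans A q (hd0 r) of (q', b, d) \<Rightarrow> (q', moved d b l r))"

fun represents :: "machine \<Rightarrow> config \<Rightarrow> nat \<times> nat list \<times> nat list \<Rightarrow> bool" where
  "represents A (q, T, i) (q', l, r) \<longleftrightarrow> q = q' \<and> q < nstates A \<and> (\<forall>j. T j < nsyms A) \<and>
     (\<forall>j. T (i + int j) = nth0 r j) \<and> (\<forall>j. T (i - 1 - int j) = nth0 l j)"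

lemma nth0_simps [simp]:
  "nth0 (b # xs) 0 = b" "nth0 (b # xs) (Suc j) = nth0 xs j" "nth0 (tl xs) j = nth0 xs (Suc j)"
  "nth0 [] j = 0"
  by (cases xs; simp add: nth0_def nth_tl)+

lemma hd0_conv_nth0: "hd0 xs = nth0 xs 0"
  by (cases xs) (simp_all add: nth0_def hd0_def)

lemma represents_step:
  assumes "wf_machine A" "represents A (q, T, i) (q, l, r)"
  shows "represents A (step A (q, T, i)) (stack_step A (q, l, r))"
proof -
  from assms(2) have q: "q < nstates A" and T: "\<And>j. T j < nsyms A"
    and r: "\<And>j. T (i + int j) = nth0 r j" and l: "\<And>j. T (i - 1 - int j) = nth0 l j"
    by auto
  have a: "hd0 r = T i"
    using r[of 0] by (simp add: hd0_conv_nth0)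
  obtain q' b d where tr: "total_trans A q (T i) = (q', b, d)"
    by (metis prod_cases3)
  have "q' < nstates A \<and> b < nsyms A" if "transition A q (T i) = (q', b, d)"
    using assms(1) q T[of i] that unfolding wf_machine_def by blast
  then have q': "q' < nstates A \<and> b < nsyms A"
    using tr q T[of i] by (simp add: total_trans_def split: if_splits)
  have step: "step A (q, T, i) = (q', T(i := b), shift d i)"
    using tr by (auto simp: total_trans_def split: if_splits)
  have pos: "T (i + int (Suc j)) = nth0 r (Suc j)" "T (i - 1 - int (Suc j)) = nth0 l (Suc j)" for j
    using r l by blast+
  show ?thesis
  proof (cases d)
    case MoveL
    have "(T(i := b)) (i - 1 + int j) = nth0 (hd0 l # b # tl r) j" for j
    proof (cases j)
      case (Suc j')
      then show ?thesis
        using pos(1) by (cases j') (auto simp: algebra_simps)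
    qed (use l[of 0] in \<open>simp add: hd0_conv_nth0\<close>)
    moreover have "(T(i := b)) (i - 1 - 1 - int j) = nth0 (tl l) j" for j
      using pos(2)[of j] by (simp add: algebra_simps)
    ultimately show ?thesis
      using a tr q' T step MoveL by simp
  next
    case Stay
    have "(T(i := b)) (i + int j) = nth0 (b # tl r) j" for j
      using pos(1) by (cases j) auto
    moreover have "(T(i := b)) (i - 1 - int j) = nth0 l j" for j
      using l[of j] by simp
    ultimately show ?thesis
      using a tr q' T step Stay by simp
  next
    case MoveR
    have "(T(i := b)) (i + 1 + int j) = nth0 (tl r) j" for j
      using pos(1)[of j] by (simp add: algebra_simps)
    moreover have "(T(i := b)) (i + 1 - 1 - int j) = nth0 (b # l) j" for j
    proof (cases j)
      case (Suc j')
      then show ?thesis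
        using l[of j'] by (simp add: algebra_simps)
    qed simp
    ultimately show ?thesis
      using a tr q' T step MoveR by simp
  qed
qed

lemma represents_run:
  assumes "wf_machine A" "set w \<subseteq> {..<nsyms A}"
  shows "represents A (run A w t) ((stack_step A ^^ t) (0, [], w))"
proof (induction t)
  case 0
  have "w ! n < nsyms A" if "n < length w" for n
    using assms(2) nth_mem[OF that] by blast
  then have "init_tape w j < nsyms A" for j
    using assms(1) by (auto simp: init_tape_def wf_machine_def nat_less_iff)
  moreover have "init_tape w (int j) = nth0 w j" "init_tape w (- 1 - int j) = 0" for j
    by (simp_all add: init_tape_def nth0_def)
  ultimately show ?case
    using assms(1) by (simp add: run_def wf_machine_def)
next
  case (Suc t)
  then show ?case
    using represents_step[OF assms(1)]
    by (cases "run A w t"; cases "(stack_step A ^^ t) (0, [], w)") (auto simp: run_def)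
qed

fun conf :: "nat \<times> nat list \<times> nat list \<Rightarrow> 'a hw" where
  "conf (q, l, r) = Ls [un q, Ls (map un (rev l)), Ls (map un (rev r))]"

definition move_code :: "move \<Rightarrow> nat" where
  "move_code d = (case d of MoveL \<Rightarrow> 0 | Stay \<Rightarrow> 1 | MoveR \<Rightarrow> 2)"

definition entry :: "machine \<Rightarrow> nat \<Rightarrow> nat \<Rightarrow> 'a hw" where
  "entry A q a = (case total_trans A q a of (q', b, d) \<Rightarrow> Ls [un q', un b, un (move_code d)])"

definition trans_table :: "machine \<Rightarrow> 'a hw list" where
  "trans_table A =
     rev (map (\<lambda>q. Ls (rev (map (entry A q) [0..<nsyms A]))) [0..<nstates A])"

lemma map_hw_entry [simp]: "map_hw f (entry A q a) = entry A q a"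
  by (simp add: entry_def split: prod.split)

lemma map_hw_trans_table [simp]: "map (map_hw f) (trans_table A) = trans_table A"
  by (simp add: trans_table_def rev_map[symmetric] o_def)

lemma set_hw_entry [simp]: "set_hw (entry A q a) = {}"
  by (auto simp: entry_def split: prod.split)

lemma set_hw_trans_table: "c \<in> set (trans_table A) \<Longrightarrow> set_hw c = {}"
  by (auto simp: trans_table_def)

text \<open>One step of the machine on the configuration in list variable 6.\<close>

definition step_term :: "machine \<Rightarrow> lterm" where
  "step_term A =
     (let q = LHead (LTail (LTail (LVar 6))); l = LHead (LTail (LVar 6)); r = LHead (LVar 6);
        en = nth_term (nth_term (LConst (trans_table A)) q) (LHead r);
        b = LHead (LTail en);
        mk = (\<lambda>l r. TL (LCons (LCons (LCons (LConst []) (TL (LHead (LTail (LTail en))))) (TL l)) (TL r)));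
        r' = LCons (LTail r) (TL b)
      in nth_term
        (LCons (LCons (LCons (LConst [])
          (mk (LCons l (TL b)) (LTail r)))
          (mk l r'))
          (mk (LTail l) (LCons r' (TL (LHead l)))))
        (LHead en))"

lemma step_term_syntax: "lterm_ok \<Sigma> (step_term A)" "fv_lterm (step_term A) = {LV 6}"
  by (auto simp: step_term_def Let_def set_hw_trans_table)

lemma lval_step_term:
  assumes "e (LV 6) = conf (q, l, r)" "q < nstates A" "hd0 r < nsyms A"
  shows "lval M (step_term A) e = conf (stack_step A (q, l, r))"
proof -
  obtain q' b d where tr: "total_trans A q (hd0 r) = (q', b, d)"
    by (metis prod_cases3)
  have head: "hw_head (Ls (map un (rev xs))) = un (hd0 xs)" for xs
    by (cases xs) (simp_all add: hw_head_Ls hd0_def)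
  have tail: "hw_tail (Ls (map un (rev xs))) = Ls (map un (rev (tl xs)))" for xs
    by (cases xs) (simp_all add: hw_tail_Ls butlast_append)
  have q: "lval M (LHead (LTail (LTail (LVar 6)))) e = un q"
    and l: "lval M (LHead (LTail (LVar 6))) e = Ls (map un (rev l))"
    and r: "lval M (LHead (LVar 6)) e = Ls (map un (rev r))"
    by (simp_all add: assms(1) hw_head_Ls hw_tail_Ls)
  have a: "lval M (LHead (LHead (LVar 6))) e = un (hd0 r)"
    using r head by simp
  define en where "en = nth_term (nth_term (LConst (trans_table A))
    (LHead (LTail (LTail (LVar 6))))) (LHead (LHead (LVar 6)))"
  have "lval M (nth_term (LConst (trans_table A)) (LHead (LTail (LTail (LVar 6))))) e =
      map (\<lambda>q. Ls (rev (map (entry A q) [0..<nsyms A]))) [0..<nstates A] ! q"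
  proof (rule lval_nth_term[OF _ q])
    show "lval M (LConst (trans_table A)) e =
        Ls (rev (map (\<lambda>q. Ls (rev (map (entry A q) [0..<nsyms A]))) [0..<nstates A]))"
      by (simp only: lval.simps map_hw_trans_table) (simp add: trans_table_def)
  qed (use assms(2) in simp)
  then have "lval M (nth_term (LConst (trans_table A)) (LHead (LTail (LTail (LVar 6))))) e =
      Ls (rev (map (entry A q) [0..<nsyms A]))"
    using assms(2) by simp
  from lval_nth_term[OF this a] have "lval M en e = entry A q (hd0 r)"
    using assms(3) by (simp add: en_def)
  then have en: "lval M en e = Ls [un q', un b, un (move_code d)]"
    by (simp add: entry_def tr)
  define mk where "mk l r =
    LCons (LCons (LCons (LConst []) (TL (LHead (LTail (LTail en))))) (TL l)) (TL r)" for l r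
  have mk: "lval M (mk lt rt) e = conf (q', l', r')"
    if "lval M lt e = Ls (map un (rev l'))" "lval M rt e = Ls (map un (rev r'))" for lt rt l' r'
    using that by (simp add: mk_def en hw_head_Ls hw_tail_Ls hw_cons_def)
  define r' where "r' = LCons (LTail (LHead (LVar 6))) (TL (LHead (LTail en)))"
  have r': "lval M r' e = Ls (map un (rev (b # tl r)))"
    using r tail[of r] by (simp add: r'_def en hw_head_Ls hw_tail_Ls hw_cons_def)
  have cR: "lval M (mk (LCons (LHead (LTail (LVar 6))) (TL (LHead (LTail en)))) (LTail (LHead (LVar 6)))) e =
      conf (q', moved MoveR b l r)"
    using r l tail[of r] unfolding moved.simps
    by (intro mk) (simp_all add: en hw_head_Ls hw_tail_Ls hw_cons_def)
  have cS: "lval M (mk (LHead (LTail (LVar 6))) r') e = conf (q', moved Stay b l r)"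
    using l r' unfolding moved.simps by (intro mk) simp_all
  have cL: "lval M (mk (LTail (LHead (LTail (LVar 6)))) (LCons r' (TL (LHead (LHead (LTail (LVar 6))))))) e =
      conf (q', moved MoveL b l r)"
    using l r' tail[of l] head[of l] unfolding moved.simps
    by (intro mk) (simp_all add: hw_cons_def)
  \<comment> \<open>Terms have no conditional. All three successor configurations are formed, and
    the coded direction of the move is the index that selects one of them.\<close>
  have "lval M (step_term A) e =
      [conf (q', moved MoveL b l r), conf (q', moved Stay b l r), conf (q', moved MoveR b l r)] ! move_code d"
    unfolding step_term_def Let_def en_def[symmetric] r'_def[symmetric] mk_def[symmetric]
  proof (rule lval_nth_term)
    show "lval M (LHead en) e = un (move_code d)"
      by (simp add: en hw_head_Ls)
    show "move_code d < length [conf (q', moved MoveL b l r), conf (q', moved Stay b l r), conf (q', moved MoveR b l r)]"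
      by (simp add: move_code_def split: move.split)
  qed (simp add: cR cS cL hw_cons_def del: moved.simps conf.simps)
  also have "\<dots> = conf (stack_step A (q, l, r))"
    by (simp only: stack_step.simps tr) (simp add: move_code_def split: move.split)
  finally show ?thesis .
qed

text \<open>The start value is the initial configuration: \<open>un 0\<close> for the state, the
  empty left stack, and the input in list variable 0 as right stack. Of \<open>t\<close> only the
  length matters; each element triggers one step.\<close>

definition run_term :: "machine \<Rightarrow> lterm \<Rightarrow> lterm" where
  "run_term A t = LRec (LCons (LConst [Ls [], Ls []]) (TL (LVar 0))) 6 2 (step_term A) t"

lemma lval_run_term:
  assumes "wf_machine A" "set w \<subseteq> {..<nsyms A}" "e (LV 0) = Ls (map un (rev w))"
  shows "lval M (run_term A t) e = conf ((stack_step A ^^ length (elems (lval M t e))) (0, [], w))"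
proof -
  have *: "foldl (\<lambda>g b. lval M (step_term A) (e(LV 6 := g, LV 2 := b))) (conf (0, [], w)) bs =
      conf ((stack_step A ^^ length bs) (0, [], w))" for bs
  proof (induction bs rule: rev_induct)
    case (snoc b bs)
    obtain q l r where s: "(stack_step A ^^ length bs) (0, [], w) = (q, l, r)"
      by (metis prod_cases3)
    obtain q' T i where c: "run A w (length bs) = (q', T, i)"
      by (metis prod_cases3)
    \<comment> \<open>The actual run is consulted only for the bounds on state and scanned symbol
      that \<open>lval_step_term\<close> requires.\<close>
    have "represents A (q', T, i) (q, l, r)"
      using represents_run[OF assms(1,2), of "length bs"] s c by simp
    then have "q < nstates A" "hd0 r < nsyms A"
      by (auto simp: hd0_conv_nth0) (metis add.right_neutral of_nat_0)
    then have "lval M (step_term A) (e(LV 6 := conf (q, l, r), LV 2 := b)) = conf (stack_step A (q, l, r))"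
      by (intro lval_step_term) simp_all
    moreover have "(stack_step A ^^ length (bs @ [b])) (0, [], w) = stack_step A (q, l, r)"
      by (simp add: s del: stack_step.simps)
    ultimately show ?case
      unfolding foldl_append foldl.simps snoc s by (simp only:)
  qed simp
  show ?thesis
    using *[of "elems (lval M t e)"] by (simp add: run_term_def assms(3) hw_cons_def)
qed

section \<open>Time bounds as lengths of lists\<close>

text \<open>Horner's scheme on lengths: concatenation adds, and appending list variable 0 once per
  element of \<open>t\<close> multiplies.\<close>

lemma ex_poly_term:
  "\<exists>t. (\<forall>\<Sigma>. lterm_ok \<Sigma> t) \<and> fv_lterm t \<subseteq> {LV 0} \<and>
     (\<forall>(M :: 'u struct) e. length (elems (lval M t e)) = poly p (length (elems (e (LV 0)))))"
proof (induction p)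
  case 0
  show ?case
    by (intro exI[of _ "LConst []"]) simp
next
  case (pCons a p)
  then obtain t where t: "\<forall>\<Sigma>. lterm_ok \<Sigma> t" "fv_lterm t \<subseteq> {LV 0}"
    "\<And>(M :: 'u struct) e. length (elems (lval M t e)) = poly p (length (elems (e (LV 0))))"
    by blast
  have *: "length (elems (foldl (\<lambda>g b. hw_conc g s) (Ls xs) bs)) = length xs + length bs * length (elems s)"
    for s :: "'u hw" and xs bs :: "'u hw list"
    by (induction bs arbitrary: xs) (simp_all add: hw_conc_def)
  show ?case
    using t *[of _ "[]"]
    by (intro exI[of _ "LConc (LConst (replicate a (Ls [])))
          (LRec (LConst []) 6 2 (LConc (LVar 6) (LVar 0)) t)"])
       (auto simp: hw_conc_def mult.commute)
qed

text \<open>Doubling a one-element list along a list of length \<open>l\<close> yields length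
  \<open>2 ^ l\<close>, so each exponential costs one further recursion around the previous
  term.\<close>

lemma ex_time_term:
  "\<exists>t. (\<forall>\<Sigma>. lterm_ok \<Sigma> t) \<and> fv_lterm t \<subseteq> {LV 0} \<and>
     (\<forall>(M :: 'u struct) e. length (elems (lval M t e)) = exp_iter k (poly p (length (elems (e (LV 0))))))"
proof (induction k)
  case 0
  then show ?case
    using ex_poly_term by simp
next
  case (Suc k)
  then obtain t where t: "\<forall>\<Sigma>. lterm_ok \<Sigma> t" "fv_lterm t \<subseteq> {LV 0}"
    "\<And>(M :: 'u struct) e. length (elems (lval M t e)) = exp_iter k (poly p (length (elems (e (LV 0)))))"
    by blast
  have *: "length (elems (foldl (\<lambda>g b. hw_conc g g) (Ls xs) bs)) = length xs * 2 ^ length bs"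
    for xs bs :: "'u hw list"
    by (induction bs arbitrary: xs) (simp_all add: hw_conc_def)
  show ?case
    using t *[of "[Ls []]"]
    by (intro exI[of _ "LRec (LConst [Ls []]) 6 2 (LConc (LVar 6) (LVar 6)) t"]) auto
qed

text \<open>\<open>W\<close> must occur exactly once in the string, both for the letter-wise
  reduction and for self-reference, although the input and the time bound both depend on it.\<close>

lemma ex_acceptance_sentence:
  assumes "wf_machine A"
  shows "\<exists>F. (\<exists>pre post. \<forall>W. str_fm (F W) = pre @ str_lterm W @ post) \<and>
    (\<forall>\<Sigma> W. lterm_ok \<Sigma> W \<and> fv_lterm W = {} \<longrightarrow> delta0_rec \<Sigma> (F W) \<and> fv_fm (F W) = {}) \<and>
    (\<forall>(M :: 'u struct) W e w. lval M W e = Ls (map un (rev w)) \<and> set w \<subseteq> {..<nsyms A} \<longrightarrow>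
       (sat M (F W) e \<longleftrightarrow> fst (run A w (exp_iter k (poly p (length w)))) = acc_state A))"
proof -
  obtain t where t: "\<forall>\<Sigma>. lterm_ok \<Sigma> t" "fv_lterm t \<subseteq> {LV 0}"
    "\<And>(M :: 'u struct) e. length (elems (lval M t e)) = exp_iter k (poly p (length (elems (e (LV 0)))))"
    using ex_time_term by blast
  \<comment> \<open>A recursion along the one-element list with entry \<open>W\<close> acts as a
    let: it binds list variable 0 to the value of \<open>W\<close> for input and time bound
    alike.\<close>
  define F where "F W = Eq (TL (LRec (LConst []) 5 0 (LHead (LTail (LTail (run_term A t))))
    (LCons (LConst []) (TL W)))) (TL (LConst (replicate (acc_state A) (Ls []))))" for W
  have "\<exists>pre post. \<forall>W. str_fm (F W) = pre @ str_lterm W @ post"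
    by (intro exI[of _ "LPar # RecS # LBrack # NilS # Comma # str_var (LV 5) @ Comma # str_var (LV 0) @
        Comma # str_lterm (LHead (LTail (LTail (run_term A t)))) @ Comma # ConsS # LPar # NilS # [Comma]"]
      exI[of _ "RPar # RBrack # EqS # str_lterm (LConst (replicate (acc_state A) (Ls []))) @ [RPar]"])
       (simp add: F_def del: str_lterm.simps(3,4))
  moreover have "delta0_rec \<Sigma> (F W) \<and> fv_fm (F W) = {}" if "lterm_ok \<Sigma> W" "fv_lterm W = {}" for \<Sigma> W
    using that t(1,2) by (auto simp: F_def run_term_def step_term_syntax)
  moreover have "sat M (F W) e \<longleftrightarrow> fst (run A w (exp_iter k (poly p (length w)))) = acc_state A"
    if W: "lval M W e = Ls (map un (rev w))" and w: "set w \<subseteq> {..<nsyms A}" for M :: "'u struct" and W e w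
  proof -
    let ?n = "exp_iter k (poly p (length w))"
    let ?e = "e(LV 5 := Ls [], LV 0 := lval M W e)"
    obtain q l r where s: "(stack_step A ^^ ?n) (0, [], w) = (q, l, r)"
      by (metis prod_cases3)
    obtain q' T i where c: "run A w ?n = (q', T, i)"
      by (metis prod_cases3)
    have q: "q' = q"
      using represents_run[OF assms w, of ?n] s c by simp
    have "lval M (run_term A t) ?e = conf (q, l, r)"
      using lval_run_term[OF assms w, of ?e M t] t(3)[of M ?e] W s by simp
    then show ?thesis
      by (simp add: F_def hw_cons_def hw_tail_Ls hw_head_Ls c q un_inject flip: un_def)
  qed
  ultimately show ?thesis
    by blast
qed

section \<open>A self-referential sentence\<close>

definition enc :: "sym list \<Rightarrow> 'a hw list" where
  "enc xs = map (\<lambda>s. un (sym_code s)) xs"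

lemma map_hw_enc [simp]: "map (map_hw f) (enc xs) = enc xs"
  by (simp add: enc_def)

lemma set_hw_enc [simp]: "c \<in> set (enc xs) \<Longrightarrow> set_hw c = {}"
  by (auto simp: enc_def)

lemma enc_append: "enc (xs @ ys) = enc xs @ enc ys"
  by (simp add: enc_def)

lemma enc_Nil [simp]: "enc [] = []"
  by (simp add: enc_def)

lemma enc_Cons: "enc (s # xs) = un (sym_code s) # enc xs"
  by (simp add: enc_def)

lemma enc_concat: "enc (concat xss) = concat (map enc xss)"
  by (induction xss) (simp_all add: enc_def)

lemma length_enc [simp]: "length (enc xs) = length xs"
  by (simp add: enc_def)

definition un_string :: "nat \<Rightarrow> sym list" where
  "un_string n = str_const (un n)"

lemma commas_replicate:
  "commas (replicate (Suc n) xs) = xs @ concat (replicate n (Comma # xs))"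
  by (induction n) simp_all

lemma un_string_Suc: "un_string (Suc n) = [LAngle, NilS] @ concat (replicate n [Comma, NilS]) @ [RAngle]"
  using commas_replicate[of n "[NilS]"] by (simp add: un_string_def un_def map_replicate_const)

text \<open>A chain of \<open>LCons\<close> instead of one constant list: in its string every symbol
  contributes the same kind of block, with no exception for the first element or the empty list, so
  simple recursions can produce that string.\<close>

definition quote :: "sym list \<Rightarrow> lterm" where
  "quote xs = foldl (\<lambda>t s. LCons t (TL (LConst (replicate (sym_code s) (Ls []))))) (LConst []) xs"

lemma lval_quote: "lval M (quote xs) e = Ls (enc xs)"
  by (induction xs rule: rev_induct) (simp_all add: quote_def enc_def hw_cons_def un_def)

lemma quote_syntax [simp]: "lterm_ok \<Sigma> (quote xs)" "fv_lterm (quote xs) = {}"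
  by (induction xs rule: rev_induct) (simp_all add: quote_def)

lemma str_quote:
  "str_lterm (quote xs) = concat (replicate (length xs) [ConsS, LPar]) @ [NilS] @
     concat (map (\<lambda>s. [Comma] @ un_string (sym_code s) @ [RPar]) xs)"
proof (induction xs rule: rev_induct)
  case (snoc s xs)
  then show ?case
    by (simp add: quote_def un_string_def un_def)
qed (simp add: quote_def)

lemma foldl_hw_conc:
  assumes "\<And>b. b \<in> set bs \<Longrightarrow> f b = Ls (c b)"
  shows "foldl (\<lambda>g b. hw_conc g (f b)) (Ls xs) bs = Ls (xs @ concat (map c bs))"
  using assms by (induction bs arbitrary: xs) (simp_all add: hw_conc_def)

text \<open>List variable 9 holds a symbol code. Codes are positive, so the string always has the
  shape of \<open>un_string_Suc\<close>; the recursion runs along the tail because the first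
  \<open>NilS\<close> is not preceded by a comma.\<close>

definition element_string_term :: lterm where
  "element_string_term = LConc (LConst (enc [Comma, LAngle, NilS]))
     (LConc (LRec (LConst []) 10 11 (LConc (LVar 10) (LConst (enc [Comma, NilS]))) (LTail (LVar 9)))
       (LConst (enc [RAngle, RPar])))"

lemma lval_element_string_term:
  fixes M :: "'u struct"
  assumes "e (LV 9) = un (sym_code s)"
  shows "lval M element_string_term e = Ls (enc ([Comma] @ un_string (sym_code s) @ [RPar]))"
proof -
  obtain n where n: "sym_code s = Suc n"
    using sym_code_range[of s] by (cases "sym_code s") auto
  have "foldl (\<lambda>g b. hw_conc g (Ls (enc [Comma, NilS]))) (Ls [] :: 'u hw) (replicate n (Ls [] :: 'u hw)) =
      Ls (enc (concat (replicate n [Comma, NilS])))"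
    by (subst foldl_hw_conc[OF refl]) (simp add: enc_concat map_replicate_const)
  then show ?thesis
    using assms unfolding n un_string_Suc
    by (simp add: element_string_term_def hw_conc_def enc_append hw_tail_def butlast_conv_take
        del: replicate_Suc)
       (simp add: enc_def)
qed

definition quote_string_term :: lterm where
  "quote_string_term =
     LConc (LRec (LConst []) 8 9 (LConc (LVar 8) (LConst (enc [ConsS, LPar]))) (LVar 7))
       (LConc (LConst (enc [NilS]))
         (LRec (LConst []) 8 9 (LConc (LVar 8) element_string_term) (LVar 7)))"

lemma lval_quote_string_term:
  fixes M :: "'u struct"
  assumes "e (LV 7) = Ls (enc xs)"
  shows "lval M quote_string_term e = Ls (enc (str_lterm (quote xs)))"
proof -
  have "foldl (\<lambda>g b. hw_conc g (Ls (enc [ConsS, LPar]))) (Ls [] :: 'u hw) (enc xs :: 'u hw list) =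
      Ls (enc (concat (replicate (length xs) [ConsS, LPar])))"
    by (subst foldl_hw_conc[OF refl])
      (simp add: enc_concat map_replicate_const)
  moreover have "foldl (\<lambda>g b. hw_conc g (lval M element_string_term (e(LV 8 := g, LV 9 := b)))) (Ls ys) (enc xs) =
      Ls (ys @ enc (concat (map (\<lambda>s. [Comma] @ un_string (sym_code s) @ [RPar]) xs)))" for ys
  proof (induction xs arbitrary: ys)
    case (Cons s xs)
    have "lval M element_string_term (e(LV 8 := Ls ys, LV 9 := un (sym_code s))) =
        Ls (enc ([Comma] @ un_string (sym_code s) @ [RPar]))"
      by (rule lval_element_string_term) simp
    then have eq: "foldl (\<lambda>g b. hw_conc g (lval M element_string_term (e(LV 8 := g, LV 9 := b)))) (Ls ys) (enc (s # xs)) =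
      foldl (\<lambda>g b. hw_conc g (lval M element_string_term (e(LV 8 := g, LV 9 := b))))
        (Ls (ys @ enc ([Comma] @ un_string (sym_code s) @ [RPar]))) (enc xs)"
      by (simp add: enc_def hw_conc_def)
    show ?case
      unfolding eq Cons.IH by (simp add: enc_def)
  qed (simp add: enc_def)
  ultimately show ?thesis
    using assms by (simp add: quote_string_term_def str_quote hw_conc_def enc_append enc_Cons[of NilS])
qed

text \<open>
  The string of \<open>H W\<close> is \<open>P @ str_lterm (quote P) @ S\<close>.  The suffix \<open>S\<close> is the same for
  every \<open>W\<close>, so it can be a constant of \<open>W\<close>; only \<open>P\<close> has to be quoted.
\<close>

lemma ex_self_reference:
  assumes "\<And>W. str_fm (H W) = pre @ str_lterm W @ post"
  shows "\<exists>W. (\<forall>\<Sigma>. lterm_ok \<Sigma> W) \<and> fv_lterm W = {} \<and>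
    (\<forall>(M :: 'u struct) e. lval M W e = Ls (map un (rev (map sym_code (str_fm (H W))))))"
proof -
  \<comment> \<open>The three brackets close the \<open>LCons\<close> around the quotation, the
    recursion that binds variable 7, and the outer recursion of \<open>rev_term\<close>.\<close>
  define S where "S = [RPar, RBrack, RBrack] @ post"
  define body where "body = LConc (LVar 7) (LConc quote_string_term (LConst (enc S)))"
  \<comment> \<open>The inner recursion binds variable 7 to the quoted string. \<open>body\<close>
    then yields the sentence in reading order, and \<open>rev_term\<close> brings it into the
    reversed order that words have as inputs.\<close>
  define W where "W P = rev_term (LRec (LConst []) 5 7 body (LCons (LConst []) (TL (quote P))))" for P
  have "\<exists>r. \<forall>t. str_lterm (rev_term t) = r @ str_lterm t @ [RBrack]"
    unfolding rev_term_def
    by (rule exI[of _ "RecS # LBrack # NilS # Comma # str_var (LV 3) @ Comma # str_var (LV 4) @ Comma #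
      str_lterm (LConc (LCons (LConst []) (TL (LVar 4))) (LVar 3)) @ [Comma]"]) simp
  then obtain r where r: "\<And>t. str_lterm (rev_term t) = r @ str_lterm t @ [RBrack]"
    by blast
  have "\<exists>q. \<forall>P. str_fm (H (W P)) = q @ str_lterm (quote P) @ S"
    unfolding assms W_def r
    by (rule exI[of _ "pre @ r @ RecS # LBrack # NilS # Comma # str_var (LV 5) @ Comma # str_var (LV 7) @
      Comma # str_lterm body @ Comma # ConsS # LPar # NilS # [Comma]"]) (simp add: S_def)
  \<comment> \<open>The prefix \<open>q\<close> contains \<open>body\<close> but is the same for
    every \<open>P\<close>, so \<open>P\<close> can be taken to be \<open>q\<close> itself. This
    closes the circle.\<close>
  then obtain P where P: "str_fm (H (W P)) = P @ str_lterm (quote P) @ S"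
    by blast
  have "lval M (W P) e = Ls (map un (rev (map sym_code (str_fm (H (W P))))))" for M :: "'u struct" and e
  proof -
    let ?e = "e(LV 5 := Ls [], LV 7 := Ls (enc P))"
    have "lval M quote_string_term ?e = Ls (enc (str_lterm (quote P)))"
      by (rule lval_quote_string_term) simp
    then have "lval M body ?e = Ls (enc (str_fm (H (W P))))"
      unfolding P by (simp add: body_def hw_conc_def enc_append)
    then show ?thesis
      unfolding W_def by (simp add: lval_rev_term lval_quote hw_cons_def) (simp add: enc_def rev_map o_def)
  qed
  moreover have "lterm_ok \<Sigma> (W P)" "fv_lterm (W P) = {}" for \<Sigma>
    by (auto simp: W_def body_def quote_string_term_def element_string_term_def)
  ultimately show ?thesis
    by blast
qed

definition default_assignment :: "'u assignment" where
  "default_assignment x = (case x of UV n \<Rightarrow> Ur undefined | LV n \<Rightarrow> Ls [])"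

lemma sorted_default_assignment: "sorted_assignment default_assignment"
  by (auto simp: sorted_assignment_def default_assignment_def is_ur_def elim: has_sort.elims split: var.split)

text \<open>Injectivity of strings identifies the formula behind the string, and the existence of a
  sorted assignment keeps the quantification over assignments from being vacuous.\<close>

lemma in_true_sentences_iff:
  assumes "delta0_rec \<Sigma> \<phi>" "fv_fm \<phi> = {}" "\<And>e. sat M \<phi> e \<longleftrightarrow> P"
  shows "map sym_code (str_fm \<phi>) \<in> true_sentences \<Sigma> M \<longleftrightarrow> P"
  using assms sorted_default_assignment
  by (auto simp: true_sentences_def map_sym_code_inject str_fm_inject)

theorem not_elementary_true_sentences:
  fixes M :: "'u struct"
  shows "\<not> elementary num_syms (true_sentences \<Sigma> M)"
proof
  assume "elementary num_syms (true_sentences \<Sigma> M)"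
  then obtain k A and p :: "nat poly" where
    A: "decides_in_time num_syms (true_sentences \<Sigma> M) A (\<lambda>n. exp_iter k (poly p n))"
    by (auto simp: elementary_def kEXPTIME_def)
  then have wf: "wf_machine A" and syms: "num_syms < nsyms A"
    by (auto simp: decides_in_time_def)
  from ex_acceptance_sentence[OF wf, of k p] obtain F pre post where
    str: "\<And>W. str_fm (F W) = pre @ str_lterm W @ post"
    and ok: "\<And>\<Sigma> W. lterm_ok \<Sigma> W \<Longrightarrow> fv_lterm W = {} \<Longrightarrow> delta0_rec \<Sigma> (F W) \<and> fv_fm (F W) = {}"
    and sat: "\<And>(M :: 'u struct) W e w. lval M W e = Ls (map un (rev w)) \<Longrightarrow> set w \<subseteq> {..<nsyms A} \<Longrightarrow>
       (sat M (F W) e \<longleftrightarrow> fst (run A w (exp_iter k (poly p (length w)))) = acc_state A)"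
    by blast
  have "str_fm (Neg (F W)) = (NegS # pre) @ str_lterm W @ post" for W
    by (simp add: str)
  from ex_self_reference[of "\<lambda>W. Neg (F W)", OF this] obtain W where
    W: "\<And>\<Sigma>. lterm_ok \<Sigma> W" "fv_lterm W = {}"
    "\<And>(M :: 'u struct) e. lval M W e = Ls (map un (rev (map sym_code (str_fm (Neg (F W))))))"
    by blast
  define w where "w = map sym_code (str_fm (Neg (F W)))"
  have w: "w \<in> lists {1..num_syms}" "set w \<subseteq> {..<nsyms A}"
  proof -
    have "set w \<subseteq> {1..num_syms}"
      unfolding w_def set_map using sym_code_range by blast
    then show "w \<in> lists {1..num_syms}" "set w \<subseteq> {..<nsyms A}"
      using syms by auto
  qed
  \<comment> \<open>\<open>F\<close> reads its time bound off the list that \<open>W\<close>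
    denotes. That list is the sentence itself, so the bound is automatically the one for inputs of
    this length.\<close>
  have "sat M (Neg (F W)) e \<longleftrightarrow> fst (run A w (exp_iter k (poly p (length w)))) \<noteq> acc_state A" for e
    using sat[OF W(3)[of M e, folded w_def] w(2)] by simp
  then have "w \<in> true_sentences \<Sigma> M \<longleftrightarrow> fst (run A w (exp_iter k (poly p (length w)))) \<noteq> acc_state A"
    unfolding w_def using ok[OF W(1,2)] by (intro in_true_sentences_iff) auto
  moreover have "fst (run A w (exp_iter k (poly p (length w)))) =
      (if w \<in> true_sentences \<Sigma> M then acc_state A else rej_state A)"
    using A w(1) unfolding decides_in_time_def by blast
  ultimately show False
    using wf unfolding wf_machine_def by (metis (full_types))
qed

section \<open>Letter-wise substitution in polynomial time\<close>

fun gstep :: "('q \<Rightarrow> nat \<Rightarrow> 'q \<times> nat \<times> move) \<Rightarrow> 'q set \<Rightarrow> 'q \<times> (int \<Rightarrow> nat) \<times> int \<Rightarrow> 'q \<times> (int \<Rightarrow> nat) \<times> int" where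
  "gstep \<delta> H (q, T, i) =
     (if q \<in> H then (q, T, i) else case \<delta> q (T i) of (q', b, d) \<Rightarrow> (q', T(i := b), shift d i))"

text \<open>Allows machines to be designed over a readable state type; only the renaming of states
  into numbers has to be done here.\<close>

lemma ex_machine:
  fixes \<delta> :: "'q \<Rightarrow> nat \<Rightarrow> 'q \<times> nat \<times> move"
  assumes "finite Q" "{q0, acc, rej} \<subseteq> Q" "acc \<noteq> rej" "0 < N"
    and closed: "\<And>q a q' b d. q \<in> Q \<Longrightarrow> a < N \<Longrightarrow> \<delta> q a = (q', b, d) \<Longrightarrow> q' \<in> Q \<and> b < N"
  shows "\<exists>A. wf_machine A \<and> nsyms A = N \<and>
    (\<forall>w t q T i. set w \<subseteq> {..<N} \<longrightarrow> (gstep \<delta> {acc, rej} ^^ t) (q0, init_tape w, 0) = (q, T, i) \<longrightarrow>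
       (q = acc \<longrightarrow> run A w t = (acc_state A, T, i)))"
proof -
  obtain h where h: "bij_betw h Q {0..<card Q}"
    using ex_bij_betw_finite_nat[OF assms(1)] by blast
  \<comment> \<open>Swaps 0 with the number of \<open>q0\<close>, because the initial state of a
    \<open>machine\<close> is fixed to be 0.\<close>
  define g where "g q = (if h q = 0 then h q0 else if h q = h q0 then 0 else h q)" for q
  have hQ: "h q < card Q" if "q \<in> Q" for q
    using bij_betwE[OF h] that by auto
  have inj: "inj_on g Q"
    using bij_betw_imp_inj_on[OF h] by (auto simp: g_def inj_on_def split: if_splits)
  have gQ: "g q < card Q" if "q \<in> Q" for q
    using hQ[OF that] hQ[of q0] assms(2) by (auto simp: g_def)
  have g0: "g q0 = 0"
    by (simp add: g_def)
  define A where "A = \<lparr>nstates = card Q, nsyms = N,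
    transition = (\<lambda>k a. if k < card Q \<and> k \<in> g ` Q then
       (case \<delta> (the_inv_into Q g k) a of (q', b, d) \<Rightarrow> (g q', b, d)) else (0, 0, Stay)),
    acc_state = g acc, rej_state = g rej\<rparr>"
  have A_simps: "nstates A = card Q" "nsyms A = N" "acc_state A = g acc" "rej_state A = g rej"
    by (simp_all add: A_def)
  have "0 < card Q"
    using assms(1,2) by (auto simp: card_gt_0_iff)
  have tr: "k < card Q \<and> b < N" if "transition A k' a = (k, b, d)" "a < N" for k' a k b d
  proof (cases "k' < card Q \<and> k' \<in> g ` Q")
    case True
    then obtain q where q: "q \<in> Q" "k' = g q"
      by blast
    obtain q' b' d' where "\<delta> q a = (q', b', d')"
      by (metis prod_cases3)
    with that True q closed[OF q(1) that(2) this] gQ[of q'] the_inv_into_f_f[OF inj q(1)] show ?thesis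
      by (simp add: A_def)
  qed (use that \<open>0 < card Q\<close> assms(4) in \<open>auto simp: A_def split: if_splits\<close>)
  have "g acc < card Q" "g rej < card Q" "g acc \<noteq> g rej"
    using inj assms(2,3) gQ by (simp_all add: inj_on_eq_iff)
  then have "wf_machine A"
    unfolding wf_machine_def A_simps using \<open>0 < card Q\<close> assms(4) tr by blast
  moreover have sim: "\<exists>q T i. (gstep \<delta> {acc, rej} ^^ t) (q0, init_tape w, 0) = (q, T, i) \<and> q \<in> Q \<and>
      (\<forall>j. T j < N) \<and> run A w t = (g q, T, i)" if w: "set w \<subseteq> {..<N}" for w t
  proof (induction t)
    case 0
    have "w ! n < N" if "n < length w" for n
      using w nth_mem[OF that] by blast
    then have "init_tape w j < N" for j
      using assms(4) by (auto simp: init_tape_def nat_less_iff)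
    then show ?case
      using g0 assms(2) by (simp add: run_def)
  next
    case (Suc t)
    then obtain q T i where IH: "(gstep \<delta> {acc, rej} ^^ t) (q0, init_tape w, 0) = (q, T, i)" "q \<in> Q"
      "\<And>j. T j < N" "run A w t = (g q, T, i)"
      by blast
    obtain q' b d where d: "\<delta> q (T i) = (q', b, d)"
      by (metis prod_cases3)
    have q': "q' \<in> Q" "b < N"
      using closed[OF IH(2) IH(3) d] by auto
    have "g q = g acc \<longleftrightarrow> q = acc" "g q = g rej \<longleftrightarrow> q = rej"
      using inj IH(2) assms(2) by (auto simp: inj_on_eq_iff)
    then have "step A (g q, T, i) = (if q \<in> {acc, rej} then (g q, T, i) else (g q', T(i := b), shift d i))"
      using d IH(2) gQ inj by (simp add: A_def the_inv_into_f_f)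
    moreover have "run A w (Suc t) = step A (run A w t)"
      by (simp add: run_def)
    ultimately show ?case
      using IH d q' by (cases "q \<in> {acc, rej}") auto
  qed
  moreover have "run A w t = (acc_state A, T, i)"
    if "set w \<subseteq> {..<N}" "(gstep \<delta> {acc, rej} ^^ t) (q0, init_tape w, 0) = (acc, T, i)" for w t T i
    using sim[OF that(1), of t] that(2) by (simp add: A_def)
  ultimately show ?thesis
    by (intro exI[of _ A]) (auto simp: A_def)
qed

section \<open>Tapes that hold a single word\<close>

definition word_at :: "int \<Rightarrow> nat list \<Rightarrow> int \<Rightarrow> nat" where
  "word_at i xs j = (if i \<le> j \<and> j < i + int (length xs) then xs ! nat (j - i) else 0)"

lemma word_at_init: "init_tape w = word_at 0 w"
  by (auto simp: init_tape_def word_at_def)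

lemma word_at_read: "j = i + int (length xs) \<Longrightarrow> word_at i (xs @ a # ys) j = a"
  by (simp add: word_at_def)

lemma word_at_blank: "j < i \<or> i + int (length xs) \<le> j \<Longrightarrow> word_at i xs j = 0"
  by (auto simp: word_at_def)

lemma word_at_write:
  assumes "j = i + int (length xs)"
  shows "(word_at i (xs @ a # ys))(j := b) = word_at i (xs @ b # ys)"
proof
  fix k
  show "((word_at i (xs @ a # ys))(j := b)) k = word_at i (xs @ b # ys) k"
  proof (cases "i \<le> k \<and> k \<noteq> j")
    case True
    then consider "nat (k - i) < length xs" | n where "nat (k - i) = length xs + Suc n"
      using assms less_imp_Suc_add[of "length xs" "nat (k - i)"] by fastforce
    then show ?thesis
      using True by cases (simp_all add: word_at_def nth_append)
  next
    case False
    then show ?thesis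
      using assms by (cases "k = j") (simp_all add: word_at_def)
  qed
qed

lemma word_at_prepend:
  assumes "j = i - 1"
  shows "(word_at i xs)(j := b) = word_at j (b # xs)"
proof
  fix k
  show "((word_at i xs)(j := b)) k = word_at j (b # xs) k"
  proof (cases "k \<ge> i")
    case True
    then have "nat (k - j) = Suc (nat (k - i))"
      using assms by simp
    then show ?thesis
      using True assms by (auto simp: word_at_def)
  qed (use assms in \<open>auto simp: word_at_def\<close>)
qed

lemma word_at_erase:
  assumes "j = i + int (length xs)"
  shows "(word_at i (xs @ [a]))(j := 0) = word_at i xs"
  using assms by (auto simp: word_at_def nth_append fun_eq_iff)

lemma fun_upd_idem_read: "T i = a \<Longrightarrow> T(i := a) = T"
  by auto

text \<open>
  The image is written from right to left, to the left of what is left of the input; the states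
  \<open>Travel b\<close> and \<open>Emit b j\<close> carry the number of the block to be written next.  Letters of
  the input are first shifted by \<open>n\<close>, to tell them from the letters of the output.
\<close>

datatype hstate = Shift | Seek | Look | Travel nat | Emit nat nat | Acc | Rej

locale homomorphism_machine =
  fixes m n :: nat and code :: "nat \<Rightarrow> nat list" and pre post :: "nat list"
  assumes code: "\<And>a. a \<in> {1..m} \<Longrightarrow> set (code a) \<subseteq> {1..n}"
    and pre: "set pre \<subseteq> {1..n}" and post: "set post \<subseteq> {1..n}" "post \<noteq> []"
begin

text \<open>The numbers 0 and \<open>Suc m\<close> lie outside the input alphabet and are free to
  stand for the two fixed strings.\<close>

definition block :: "nat \<Rightarrow> nat list" where
  "block b = (if b = 0 then post else if b \<le> m then code b else pre)"

text \<open>One round: \<open>Seek\<close> runs to the right end, \<open>Look\<close> erases the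
  last letter if it exceeds \<open>n\<close> and so belongs to the input, \<open>Travel\<close>
  carries it to the blank on the left, \<open>Emit\<close> writes its image there. The round for
  \<open>post\<close> comes first, straight after shifting; the round for \<open>pre\<close> comes
  last, when \<open>Look\<close> meets an output letter.\<close>

fun delta :: "hstate \<Rightarrow> nat \<Rightarrow> hstate \<times> nat \<times> move" where
  "delta Shift a = (if a = 0 then (Travel 0, 0, MoveL) else if a \<le> m then (Shift, a + n, MoveR) else (Rej, 0, Stay))"
| "delta Seek a = (if a = 0 then (Look, 0, MoveL) else (Seek, a, MoveR))"
| "delta Look a = (if n < a then (Travel (a - n), 0, MoveL) else (Travel (Suc m), a, Stay))"
| "delta (Travel b) a = (if a = 0 then (Emit b (length (block b)), 0, Stay) else (Travel b, a, MoveL))"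
| "delta (Emit b (Suc j)) a = (Emit b j, block b ! j, MoveL)"
| "delta (Emit b 0) a = (if b = Suc m then Acc else Seek, a, MoveR)"
| "delta Acc a = (Acc, a, Stay)"
| "delta Rej a = (Rej, a, Stay)"

definition reaches :: "hstate \<times> (int \<Rightarrow> nat) \<times> int \<Rightarrow> nat \<Rightarrow> hstate \<times> (int \<Rightarrow> nat) \<times> int \<Rightarrow> bool" where
  "reaches c t c' \<longleftrightarrow> (gstep delta {Acc, Rej} ^^ t) c = c'"

lemma reaches_0 [simp]: "reaches c 0 c' \<longleftrightarrow> c = c'"
  by (simp add: reaches_def)

lemma reaches_1: "reaches c 1 c' \<longleftrightarrow> gstep delta {Acc, Rej} c = c'"
  by (simp add: reaches_def)

lemma reaches_trans: "reaches c s c' \<Longrightarrow> reaches c' t c'' \<Longrightarrow> reaches c (s + t) c''"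
  by (subst add.commute) (auto simp: reaches_def funpow_add)

lemma reaches_Suc: "gstep delta {Acc, Rej} c = c' \<Longrightarrow> reaches c' t c'' \<Longrightarrow> reaches c (Suc t) c''"
  by (auto simp: reaches_def funpow_swap1)

lemma reaches_shift:
  assumes "set ys \<subseteq> {1..m}"
  shows "reaches (Shift, word_at i (xs @ ys), i + int (length xs)) (length ys)
    (Shift, word_at i (xs @ map (\<lambda>a. a + n) ys), i + int (length (xs @ ys)))"
  using assms
proof (induction ys arbitrary: xs)
  case (Cons a ys)
  have "gstep delta {Acc, Rej} (Shift, word_at i (xs @ a # ys), i + int (length xs)) =
      (Shift, word_at i ((xs @ [a + n]) @ ys), i + int (length (xs @ [a + n])))"
    using Cons.prems by (simp add: word_at_read word_at_write)
  from reaches_Suc[OF this Cons.IH] Cons.prems show ?case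
    by (simp add: algebra_simps)
qed simp

lemma reaches_seek:
  assumes "0 \<notin> set ys"
  shows "reaches (Seek, word_at i (xs @ ys), i + int (length xs)) (length ys)
    (Seek, word_at i (xs @ ys), i + int (length (xs @ ys)))"
  using assms
proof (induction ys arbitrary: xs)
  case (Cons a ys)
  have "gstep delta {Acc, Rej} (Seek, word_at i (xs @ a # ys), i + int (length xs)) =
      (Seek, word_at i ((xs @ [a]) @ ys), i + int (length (xs @ [a])))"
    using Cons.prems by (simp add: word_at_read fun_upd_idem_read)
  from reaches_Suc[OF this Cons.IH] Cons.prems show ?case
    by (simp add: algebra_simps)
qed simp

lemma reaches_travel:
  assumes "0 \<notin> set xs"
  shows "reaches (Travel b, word_at i (xs @ ys), i + int (length xs) - 1) (length xs)
    (Travel b, word_at i (xs @ ys), i - 1)"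
  using assms
proof (induction xs arbitrary: ys rule: rev_induct)
  case (snoc a xs)
  have "gstep delta {Acc, Rej} (Travel b, word_at i ((xs @ [a]) @ ys), i + int (length (xs @ [a])) - 1) =
      (Travel b, word_at i (xs @ a # ys), i + int (length xs) - 1)"
    using snoc.prems by (simp add: word_at_read fun_upd_idem_read)
  from reaches_Suc[OF this snoc.IH] snoc.prems show ?case
    by simp
qed simp

lemma reaches_emit:
  assumes "j \<le> length (block b)"
  shows "reaches (Emit b j, word_at i xs, i - 1) j
    (Emit b 0, word_at (i - int j) (take j (block b) @ xs), i - int j - 1)"
  using assms
proof (induction j arbitrary: i xs)
  case (Suc j)
  have "gstep delta {Acc, Rej} (Emit b (Suc j), word_at i xs, i - 1) =
      (Emit b j, word_at (i - 1) (block b ! j # xs), i - 1 - 1)"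
    by (simp add: word_at_prepend)
  from reaches_Suc[OF this Suc.IH] Suc.prems show ?case
    by (simp add: take_Suc_conv_app_nth algebra_simps)
qed simp

lemma reaches_write_block:
  assumes "0 \<notin> set xs"
  shows "reaches (Travel b, word_at i xs, i + int (length xs) - 1) (length xs + Suc (length (block b)))
    (Emit b 0, word_at (i - int (length (block b))) (block b @ xs), i - int (length (block b)) - 1)"
proof -
  have "gstep delta {Acc, Rej} (Travel b, word_at i xs, i - 1) =
      (Emit b (length (block b)), word_at i xs, i - 1)"
    by (simp add: word_at_blank fun_upd_idem_read)
  note emit = reaches_Suc[OF this reaches_emit[OF order_refl]]
  have "reaches (Travel b, word_at i xs, i + int (length xs) - 1) (length xs) (Travel b, word_at i xs, i - 1)"
    using reaches_travel[OF assms, of b i "[]"] by simp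
  from reaches_trans[OF this emit] show ?thesis
    by simp
qed

lemma reaches_next_block:
  assumes "b \<le> m" "0 \<notin> set (block b @ xs)" "block b @ xs = ys @ [a]"
  shows "\<exists>i'. reaches (Travel b, word_at i xs, i + int (length xs) - 1)
    (2 * length xs + 2 * length (block b) + 3)
    (Look, word_at i' (ys @ [a]), i' + int (length ys))"
proof -
  let ?zs = "block b @ xs" and ?i = "i - int (length (block b))"
  have 1: "gstep delta {Acc, Rej} (Emit b 0, word_at ?i ?zs, ?i - 1) = (Seek, word_at ?i ?zs, ?i)"
    using assms(1) by (simp add: word_at_blank fun_upd_idem_read)
  have 2: "reaches (Seek, word_at ?i ?zs, ?i) (length ?zs) (Seek, word_at ?i ?zs, ?i + int (length ?zs))"
    using reaches_seek[OF assms(2), of ?i "[]"] by simp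
  have 3: "reaches (Seek, word_at ?i ?zs, ?i + int (length ?zs)) 1 (Look, word_at ?i ?zs, ?i + int (length ys))"
    unfolding reaches_1 using assms(3) by (simp add: word_at_blank fun_upd_idem_read)
  have "reaches (Travel b, word_at i xs, i + int (length xs) - 1)
      (length xs + Suc (length (block b)) + Suc (length ?zs + 1)) (Look, word_at ?i ?zs, ?i + int (length ys))"
    using assms(2) by (intro reaches_trans[OF reaches_write_block] reaches_Suc[OF 1] reaches_trans[OF 2 3]) simp
  moreover have "length xs + Suc (length (block b)) + Suc (length ?zs + 1) =
      2 * length xs + 2 * length (block b) + 3"
    by simp
  ultimately have "reaches (Travel b, word_at i xs, i + int (length xs) - 1)
      (2 * length xs + 2 * length (block b) + 3) (Look, word_at ?i ?zs, ?i + int (length ys))"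
    by (simp only:)
  then show ?thesis
    unfolding assms(3) by blast
qed

lemma set_block: "set (block b) \<subseteq> {1..n}"
  using code[of b] pre post by (simp add: block_def)

text \<open>The induction removes the last letter because the machine consumes its input from the
  right. \<open>L\<close> bounds the word on the tape in all remaining rounds: a round trades one
  input letter for at most \<open>K\<close> output letters, which preserves the inequality. A round
  crosses the word twice, hence at most \<open>2 * L + 5\<close> steps.\<close>

lemma reaches_loop:
  assumes "set w \<subseteq> {1..m}" "set zs \<subseteq> {1..n}" "zs \<noteq> []"
    and K: "\<And>b. length (block b) \<le> K" and L: "(length w + 1) * K + length w + length zs \<le> L"
  shows "\<exists>i' t. t \<le> (length w + 1) * (2 * L + 5) \<and>
    reaches (Look, word_at i (zs @ map (\<lambda>a. a + n) w), i + int (length zs + length w) - 1) t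
      (Acc, word_at i' (pre @ concat (map code w) @ zs), i')"
  using assms
proof (induction w arbitrary: i zs rule: rev_induct)
  case Nil
  have zs: "0 \<notin> set zs"
    using Nil(2) by fastforce
  obtain a ys where ys: "zs = ys @ [a]"
    using Nil(3) by (cases zs rule: rev_cases) auto
  have "block (Suc m) = pre"
    by (simp add: block_def)
  then have 1: "reaches (Travel (Suc m), word_at i zs, i + int (length zs) - 1) (length zs + Suc (length pre))
      (Emit (Suc m) 0, word_at (i - int (length pre)) (pre @ zs), i - int (length pre) - 1)"
    using reaches_write_block[OF zs, of "Suc m" i] by simp
  have 2: "gstep delta {Acc, Rej} (Look, word_at i zs, i + int (length zs) - 1) =
      (Travel (Suc m), word_at i zs, i + int (length zs) - 1)"
    using Nil(2) by (simp add: ys word_at_read fun_upd_idem_read)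
  have 3: "reaches (Emit (Suc m) 0, word_at (i - int (length pre)) (pre @ zs), i - int (length pre) - 1) 1
      (Acc, word_at (i - int (length pre)) (pre @ zs), i - int (length pre))"
    unfolding reaches_1 by (simp add: word_at_blank fun_upd_idem_read)
  have "length pre \<le> K"
    using K[of "Suc m"] by (simp add: block_def)
  then show ?case
    using reaches_Suc[OF 2 reaches_trans[OF 1 3]] Nil(5)
    by (intro exI[of _ "i - int (length pre)"] exI[of _ "Suc (length zs + Suc (length pre) + 1)"]) simp
next
  case (snoc a w)
  let ?w = "map (\<lambda>a. a + n) w"
  have a: "1 \<le> a" "a \<le> m" and block: "block a = code a"
    using snoc.prems(1) by (auto simp: block_def)
  have zs: "0 \<notin> set (zs @ ?w)" and zs': "0 \<notin> set (block a @ zs @ ?w)"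
    using snoc.prems(1,2) set_block[of a] by fastforce+
  have 1: "gstep delta {Acc, Rej} (Look, word_at i (zs @ map (\<lambda>a. a + n) (w @ [a])),
       i + int (length zs + length (w @ [a])) - 1) =
      (Travel a, word_at i (zs @ ?w), i + int (length (zs @ ?w)) - 1)"
    using a word_at_read[of "i + int (length zs + length w)" i "zs @ ?w" "a + n" "[]"]
      word_at_erase[of "i + int (length zs + length w)" i "zs @ ?w" "a + n"] by simp
  obtain c ys where ys: "block a @ zs @ ?w = ys @ [c]"
    using snoc.prems(3) by (metis append_is_Nil_conv rev_exhaust)
  from reaches_next_block[OF a(2) zs' ys] obtain i2 where
    2: "reaches (Travel a, word_at i (zs @ ?w), i + int (length (zs @ ?w)) - 1)
      (2 * length (zs @ ?w) + 2 * length (block a) + 3)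
      (Look, word_at i2 (ys @ [c]), i2 + int (length ys))"
    by blast
  have pos: "i2 + int (length (block a @ zs) + length w) - 1 = i2 + int (length ys)"
    using arg_cong[OF ys, of length] by simp
  have tape: "(block a @ zs) @ ?w = ys @ [c]"
    using ys by simp
  have "\<exists>i' t. t \<le> (length w + 1) * (2 * L + 5) \<and>
    reaches (Look, word_at i2 ((block a @ zs) @ ?w), i2 + int (length (block a @ zs) + length w) - 1) t
      (Acc, word_at i' (pre @ concat (map code w) @ (block a @ zs)), i')"
  proof (rule snoc.IH)
    show "(length w + 1) * K + length w + length (block a @ zs) \<le> L"
      using snoc.prems(5) K[of a] by (simp add: algebra_simps)
  qed (use snoc.prems set_block[of a] in auto)
  then obtain i' t where t: "t \<le> (length w + 1) * (2 * L + 5)" and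
    3: "reaches (Look, word_at i2 (ys @ [c]), i2 + int (length ys)) t
      (Acc, word_at i' (pre @ concat (map code (w @ [a])) @ zs), i')"
    unfolding pos tape by (auto simp: block)
  have "2 * length (zs @ ?w) + 2 * length (block a) + 4 \<le> 2 * L + 5"
    using snoc.prems(5) K[of a] by simp
  then show ?case
    using reaches_Suc[OF 1 reaches_trans[OF 2 3]] t
    by (intro exI[of _ i'] exI[of _ "Suc (2 * length (zs @ ?w) + 2 * length (block a) + 3 + t)"]) simp
qed

lemma reaches_acc:
  assumes "w \<in> lists {1..m}"
    and K: "\<And>b. length (block b) \<le> K" and L: "(length w + 2) * K + length w \<le> L"
  shows "\<exists>i t. t \<le> (length w + 3) * (2 * L + 5) \<and>
    reaches (Shift, init_tape w, 0) t (Acc, word_at i (pre @ concat (map code w) @ post), i)"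
proof -
  let ?w = "map (\<lambda>a. a + n) w"
  have w: "set w \<subseteq> {1..m}"
    using assms(1) by auto
  have 1: "reaches (Shift, init_tape w, 0) (length w) (Shift, word_at 0 ?w, int (length w))"
    using reaches_shift[OF w, of 0 "[]"] by (simp add: word_at_init)
  have 2: "gstep delta {Acc, Rej} (Shift, word_at 0 ?w, int (length w)) =
      (Travel 0, word_at 0 ?w, 0 + int (length ?w) - 1)"
    by (simp add: word_at_blank fun_upd_idem_read)
  have block: "block 0 = post"
    by (simp add: block_def)
  have nz: "0 \<notin> set (block 0 @ ?w)"
    using w set_block[of 0] by fastforce
  obtain c ys where ys: "block 0 @ ?w = ys @ [c]"
    using post(2) block by (metis append_is_Nil_conv rev_exhaust)
  from reaches_next_block[OF _ nz ys] obtain i2 where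
    3: "reaches (Travel 0, word_at 0 ?w, 0 + int (length ?w) - 1)
      (2 * length ?w + 2 * length (block 0) + 3) (Look, word_at i2 (ys @ [c]), i2 + int (length ys))"
    by blast
  have "\<exists>i' t. t \<le> (length w + 1) * (2 * L + 5) \<and>
    reaches (Look, word_at i2 (post @ ?w), i2 + int (length post + length w) - 1) t
      (Acc, word_at i' (pre @ concat (map code w) @ post), i')"
    using w post K[of 0] L block by (intro reaches_loop[OF _ _ _ K]) (auto simp: algebra_simps)
  moreover have "i2 + int (length post + length w) - 1 = i2 + int (length ys)"
    using arg_cong[OF ys, of length] block by simp
  moreover have "post @ ?w = ys @ [c]"
    using ys block by simp
  ultimately obtain i' t where t: "t \<le> (length w + 1) * (2 * L + 5)" and
    4: "reaches (Look, word_at i2 (ys @ [c]), i2 + int (length ys)) t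
      (Acc, word_at i' (pre @ concat (map code w) @ post), i')"
    by metis
  have "2 * length ?w + 2 * length (block 0) + 3 \<le> 2 * L + 3"
    using L K[of 0] by (simp add: algebra_simps)
  then have "length w + Suc (2 * length ?w + 2 * length (block 0) + 3 + t) \<le> (length w + 3) * (2 * L + 5)"
    using t L by (simp add: algebra_simps)
  then show ?thesis
    using reaches_trans[OF 1 reaches_Suc[OF 2 reaches_trans[OF 3 4]]] by blast
qed

definition states :: "hstate set" where
  "states = {Shift, Seek, Look, Acc, Rej} \<union> Travel ` {..m + n + 1} \<union>
     (\<Union>b\<in>{..m + n + 1}. Emit b ` {..length (block b)})"

lemma in_states [simp]:
  "Shift \<in> states" "Seek \<in> states" "Look \<in> states" "Acc \<in> states" "Rej \<in> states"
  "Travel b \<in> states \<longleftrightarrow> b \<le> m + n + 1"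
  "Emit b j \<in> states \<longleftrightarrow> b \<le> m + n + 1 \<and> j \<le> length (block b)"
  by (auto simp: states_def)

lemma finite_states: "finite states"
  by (simp add: states_def)

lemma ptime_computable: "ptime_computable m (lists {1..m}) (\<lambda>w. pre @ concat (map code w) @ post)"
proof -
  \<comment> \<open>The blank, the \<open>n\<close> output letters and the \<open>m\<close> shifted
    input letters.\<close>
  define N where "N = Suc (m + n)"
  have closed: "q' \<in> states \<and> b < N" if "q \<in> states" "a < N" "delta q a = (q', b, d)" for q a q' b d
  proof (cases "(q, a)" rule: delta.cases)
    case (5 k j a')
    have "j < length (block k)"
      using 5 that(1) by auto
    then have "block k ! j \<in> {1..n}"
      using set_block[of k] nth_mem by blast
    then show ?thesis
      using 5 that by (auto simp: N_def)
  qed (use that in \<open>auto simp: N_def split: if_splits\<close>)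
  have "\<exists>A. wf_machine A \<and> nsyms A = N \<and>
    (\<forall>w t q T i. set w \<subseteq> {..<N} \<longrightarrow> (gstep delta {Acc, Rej} ^^ t) (Shift, init_tape w, 0) = (q, T, i) \<longrightarrow>
       (q = Acc \<longrightarrow> run A w t = (acc_state A, T, i)))"
    by (rule ex_machine[OF finite_states _ _ _ closed]) (simp_all add: N_def)
  then obtain A where A: "wf_machine A" "nsyms A = N"
    and sim: "\<And>w t T i. set w \<subseteq> {..<N} \<Longrightarrow> reaches (Shift, init_tape w, 0) t (Acc, T, i) \<Longrightarrow>
      run A w t = (acc_state A, T, i)"
    unfolding reaches_def by blast
  define K where "K = Max (length ` block ` {..Suc m})"
  have K: "length (block b) \<le> K" for b
  proof -
    have "block b = block (min b (Suc m))"
      by (auto simp: block_def min_def)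
    then show ?thesis
      unfolding K_def by (metis Max_ge atMost_iff finite_atMost finite_imageI imageI min.cobounded2)
  qed
  define p :: "nat poly" where "p = [:3, 1:] * ([:2:] * ([:2, 1:] * [:K:] + [:0, 1:]) + [:5:])"
  have p: "poly p k = (k + 3) * (2 * ((k + 2) * K + k) + 5)" for k
    by (simp add: p_def algebra_simps)
  have "fst (run A w (poly p (length w))) = acc_state A \<and>
      has_output (run A w (poly p (length w))) (pre @ concat (map code w) @ post)"
    if w: "w \<in> lists {1..m}" for w
  proof -
    let ?out = "pre @ concat (map code w) @ post"
    obtain i t where t: "t \<le> poly p (length w)" and
      "reaches (Shift, init_tape w, 0) t (Acc, word_at i ?out, i)"
      using reaches_acc[OF w K order_refl] unfolding p by blast
    then have run: "run A w t = (acc_state A, word_at i ?out, i)"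
      using w by (intro sim) (auto simp: N_def)
    have "(step A ^^ s) (acc_state A, word_at i ?out, i) = (acc_state A, word_at i ?out, i)" for s
      by (induction s) simp_all
    then have "run A w (poly p (length w) - t + t) = (acc_state A, word_at i ?out, i)"
      using run unfolding run_def funpow_add by simp
    then have "run A w (poly p (length w)) = (acc_state A, word_at i ?out, i)"
      using t by simp
    moreover have "set (code a) \<subseteq> {1..n}" if "a \<in> set w" for a
      by (rule code) (use w that in auto)
    then have "0 \<notin> set ?out"
      using pre post(1) by fastforce
    ultimately show ?thesis
      by (simp add: word_at_def del: append.simps length_append)
  qed
  then show ?thesis
    using A unfolding ptime_computable_def computes_in_time_def
    by (intro exI[of _ A] exI[of _ p]) (auto simp: N_def)
qed

end

section \<open>Hardness\<close>

lemma commas_Cons: "commas (xs # xss) = xs @ concat (map ((#) Comma) xss)"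
  by (induction xss arbitrary: xs) simp_all

text \<open>The dummy first element puts a comma before every letter, also the first one, so the
  string is a letter-wise image of \<open>w\<close>. Reversal moves the dummy to the end, where
  \<open>LTail\<close> removes it.\<close>

definition word_term :: "nat list \<Rightarrow> lterm" where
  "word_term w = LTail (rev_term (LConst (Ls [] # map un w)))"

lemma lval_word_term: "lval M (word_term w) e = Ls (map un (rev w))"
  by (simp add: word_term_def lval_rev_term hw_tail_Ls rev_map o_def)

lemma ex_word_term_string:
  "\<exists>pre post. \<forall>w. str_lterm (word_term w) = pre @ concat (map (\<lambda>a. Comma # un_string a) w) @ RAngle # post"
  by (intro exI[of _ "TailS # LPar # RecS # LBrack # NilS # Comma # str_var (LV 3) @ Comma # str_var (LV 4) @
        Comma # str_lterm (LConc (LCons (LConst []) (TL (LVar 4))) (LVar 3)) @ Comma # LAngle # [NilS]"]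
      exI[of _ "[RBrack, RPar]"])
     (simp add: word_term_def rev_term_def commas_Cons un_string_def o_def)

theorem kEXPTIME_hard_true_sentences:
  fixes M :: "'u struct"
  shows "kEXPTIME_hard k num_syms (true_sentences \<Sigma> M)"
  unfolding kEXPTIME_hard_def
proof (intro allI ballI)
  fix m L assume "L \<in> kEXPTIME k m"
  then obtain A and p :: "nat poly" where A: "decides_in_time m L A (\<lambda>n. exp_iter k (poly p n))"
    by (auto simp: kEXPTIME_def)
  then have wf: "wf_machine A" and syms: "m < nsyms A"
    by (auto simp: decides_in_time_def)
  from ex_acceptance_sentence[OF wf, of k p] obtain F pre post where
    str: "\<And>W. str_fm (F W) = pre @ str_lterm W @ post"
    and ok: "\<And>\<Sigma> W. lterm_ok \<Sigma> W \<Longrightarrow> fv_lterm W = {} \<Longrightarrow> delta0_rec \<Sigma> (F W) \<and> fv_fm (F W) = {}"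
    and sat: "\<And>(M :: 'u struct) W e w. lval M W e = Ls (map un (rev w)) \<Longrightarrow> set w \<subseteq> {..<nsyms A} \<Longrightarrow>
       (sat M (F W) e \<longleftrightarrow> fst (run A w (exp_iter k (poly p (length w)))) = acc_state A)"
    by blast
  from ex_word_term_string obtain pre' post' where
    str': "\<And>w. str_lterm (word_term w) = pre' @ concat (map (\<lambda>a. Comma # un_string a) w) @ RAngle # post'"
    by blast
  define f where "f w = map sym_code (str_fm (F (word_term w)))" for w
  have range: "set (map sym_code xs) \<subseteq> {1..num_syms}" for xs
    using sym_code_range by auto
  \<comment> \<open>Keeping the closing \<open>RAngle\<close> in the last part makes the suffix
    nonempty, as the locale demands.\<close>
  have f: "f w = map sym_code (pre @ pre') @ concat (map (\<lambda>a. map sym_code (Comma # un_string a)) w) @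
      map sym_code (RAngle # post' @ post)" for w
    by (simp add: f_def str str' map_concat o_def)
  have "ptime_computable m (lists {1..m}) f"
    unfolding f
    by (rule homomorphism_machine.ptime_computable[of m num_syms], unfold_locales) (rule range | simp)+
  moreover have "f w \<in> lists {1..num_syms} \<and> (w \<in> L \<longleftrightarrow> f w \<in> true_sentences \<Sigma> M)"
    if w: "w \<in> lists {1..m}" for w
  proof -
    have "fst (run A w (exp_iter k (poly p (length w)))) = (if w \<in> L then acc_state A else rej_state A)"
      using A w unfolding decides_in_time_def by blast
    then have "fst (run A w (exp_iter k (poly p (length w)))) = acc_state A \<longleftrightarrow> w \<in> L"
      using wf unfolding wf_machine_def by (metis (full_types))
    moreover have "set w \<subseteq> {..<nsyms A}"
      using w syms by auto
    ultimately have "sat M (F (word_term w)) e \<longleftrightarrow> w \<in> L" for e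
      using sat[OF lval_word_term] by simp
    moreover have "lterm_ok \<Sigma> (word_term w)" "fv_lterm (word_term w) = {}"
      by (auto simp: word_term_def)
    ultimately have "f w \<in> true_sentences \<Sigma> M \<longleftrightarrow> w \<in> L"
      unfolding f_def using ok by (intro in_true_sentences_iff) blast+
    then show ?thesis
      using range unfolding f_def by blast
  qed
  ultimately show "ptime_reducible m L num_syms (true_sentences \<Sigma> M)"
    unfolding ptime_reducible_def by blast
qed

section \<open>Standard formulas do not see deep nestings\<close>

primrec nest :: "nat \<Rightarrow> 'u hw" where
  "nest 0 = Ls []"
| "nest (Suc n) = Ls [nest n]"

primrec objects_at :: "nat \<Rightarrow> 'u hw \<Rightarrow> 'u hw set" where
  "objects_at 0 v = {v}"
| "objects_at (Suc d) v = (\<Union>x\<in>set (elems v). objects_at d x)"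

text \<open>A pumping map: the special clause inserts one level at \<open>nest k\<close>, so every
  \<open>nest j\<close> with \<open>k \<le> j\<close> grows by one while smaller nestings stay
  fixed.\<close>

primrec deepen :: "nat \<Rightarrow> 'u hw \<Rightarrow> 'u hw" where
  "deepen k (Ur a) = Ur a"
| "deepen k (Ls xs) = (if Ls xs = nest k then nest (Suc k) else Ls (map (deepen k) xs))"

lemma nest_inject: "nest i = nest j \<longleftrightarrow> i = j"
proof (induction i arbitrary: j)
  case 0
  then show ?case by (cases j) auto
next
  case (Suc i)
  then show ?case by (cases j) auto
qed

lemma deepen_nest: "deepen k (nest n) = nest (if k \<le> n then Suc n else n)"
proof (induction n)
  case 0
  then show ?case by (cases k) auto
next
  case (Suc n)
  show ?case
  proof (cases "k = Suc n")
    case False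
    then have "Ls [nest n] \<noteq> nest k"
      using nest_inject[of "Suc n" k] by simp
    then show ?thesis
      using Suc False by auto
  qed simp
qed

lemma deepen_nest_self: "deepen k (nest k) = nest (Suc k)"
  by (simp add: deepen_nest)

text \<open>Nothing is mapped to \<open>nest k\<close> itself, which makes \<open>deepen k\<close> injective.\<close>

lemma deepen_eq_nest: "i \<le> k \<Longrightarrow> deepen k v = nest i \<Longrightarrow> v = nest i \<and> i < k"
proof (induction i arbitrary: v)
  case 0
  then show ?case
    by (cases v; cases k) (auto split: if_splits)
next
  case (Suc i)
  obtain xs where v: "v = Ls xs"
    using Suc.prems by (cases v) auto
  have "v \<noteq> nest k"
    using Suc.prems nest_inject[of "Suc k" "Suc i"] deepen_nest_self[of k] by (metis Suc_n_not_le_n Suc_inject)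
  then obtain x where x: "xs = [x]" "deepen k x = nest i"
    using Suc.prems v by auto
  then have "x = nest i"
    using Suc by simp
  then show ?case
    using v x \<open>v \<noteq> nest k\<close> Suc.prems by (cases "Suc i = k") auto
qed

lemma deepen_inject:
  fixes v w :: "'u hw"
  shows "deepen k v = deepen k w \<longleftrightarrow> v = w"
proof
  \<comment> \<open>Only here could the two list clauses of \<open>deepen\<close> collide. The
    elementwise clause would need an element mapped to \<open>nest k\<close>, which does not
    exist.\<close>
  have nest_k: "w = nest k" if w: "deepen k w = nest (Suc k)" for w :: "'u hw"
  proof (rule ccontr)
    assume "w \<noteq> nest k"
    moreover obtain ys where "w = Ls ys"
      using w by (cases w) auto
    ultimately obtain y :: "'u hw" where "deepen k y = nest k"
      using w by auto
    then show False
      using deepen_eq_nest[of k k y] by simp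
  qed
  show "deepen k v = deepen k w \<Longrightarrow> v = w"
  proof (induction v arbitrary: w)
    case (Ur a)
    then show ?case
      by (cases w) (auto split: if_splits)
  next
    case (Ls xs)
    show ?case
    proof (cases "Ls xs = nest k \<or> w = nest k")
      case True
      then show ?thesis
      proof
        assume *: "Ls xs = nest k"
        have "deepen k w = nest (Suc k)"
          using deepen_nest_self unfolding Ls.prems[symmetric] * .
        then show ?thesis
          using * nest_k[of w] by argo
      next
        assume *: "w = nest k"
        have "deepen k (Ls xs) = nest (Suc k)"
          using deepen_nest_self unfolding Ls.prems * .
        then show ?thesis
          using * nest_k by blast
      qed
    next
      case False
      then obtain ys where w: "w = Ls ys"
        using Ls.prems by (cases w) auto
      then have "map (deepen k) xs = map (deepen k) ys"
        using False Ls.prems by simp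
      then have "xs = ys"
        by (rule list.inj_map_strong[rotated]) (use Ls.IH in blast)
      then show ?thesis
        using w by simp
    qed
  qed
qed simp

lemma deepen_id: "(\<And>d. nest k \<notin> objects_at d v) \<Longrightarrow> deepen k v = v"
proof (induction v)
  case (Ls xs)
  have "Ls xs \<noteq> nest k"
    using Ls.prems[of 0] by auto
  moreover have "deepen k x = x" if "x \<in> set xs" for x
    using Ls.IH[OF that] Ls.prems[of "Suc _"] that by auto
  ultimately show ?case
    by (simp add: map_idI)
qed simp

text \<open>Evaluating a term of length \<open>l\<close> uses up \<open>l\<close> of the margin \<open>s\<close>.\<close>

definition shallow :: "nat \<Rightarrow> nat \<Rightarrow> nat \<Rightarrow> 'u hw \<Rightarrow> bool" where
  "shallow J k s v \<longleftrightarrow> (\<forall>d i. d + s \<le> J \<longrightarrow> s \<le> i \<longrightarrow> i \<le> k \<longrightarrow> nest i \<notin> objects_at d v)"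

lemma shallow_mono: "shallow J k s v \<Longrightarrow> s \<le> s' \<Longrightarrow> shallow J k s' v"
  by (auto simp: shallow_def)

lemma shallowD: "shallow J k s v \<Longrightarrow> d + s \<le> J \<Longrightarrow> s \<le> i \<Longrightarrow> i \<le> k \<Longrightarrow> nest i \<notin> objects_at d v"
  by (simp add: shallow_def)

lemma shallow_neq_nest: "shallow J k s v \<Longrightarrow> s \<le> J \<Longrightarrow> s \<le> i \<Longrightarrow> i \<le> k \<Longrightarrow> v \<noteq> nest i"
  using shallowD[of J k s v 0 i] by simp

lemma shallow_Ls:
  assumes "\<And>x. x \<in> set xs \<Longrightarrow> \<forall>d i. Suc d + s \<le> J \<longrightarrow> s \<le> i \<longrightarrow> i \<le> k \<longrightarrow> nest i \<notin> objects_at d x"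
    and "s \<le> J \<Longrightarrow> \<forall>i. s \<le> i \<longrightarrow> i \<le> k \<longrightarrow> Ls xs \<noteq> nest i"
  shows "shallow J k s (Ls xs)"
  unfolding shallow_def
proof (intro allI impI)
  fix d i assume *: "d + s \<le> J" "s \<le> i" "i \<le> k"
  show "nest i \<notin> objects_at d (Ls xs)"
  proof (cases d)
    case 0
    then show ?thesis
      using assms(2) * by auto
  next
    case (Suc d')
    then show ?thesis
      using assms(1) * by auto
  qed
qed

lemma shallow_elem:
  assumes "shallow J k s v" "x \<in> set (elems v)"
  shows "\<forall>d i. Suc d + s \<le> J \<longrightarrow> s \<le> i \<longrightarrow> i \<le> k \<longrightarrow> nest i \<notin> objects_at d x"
  using assms unfolding shallow_def by (metis UN_iff objects_at.simps(2))

lemma shallow_nil: "0 < s \<Longrightarrow> shallow J k s (Ls [])"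
  by (rule shallow_Ls) (auto simp: nest_inject[of 0, simplified])

text \<open>Cutting off the end can create a nesting: \<open>Ls [nest i', x]\<close> becomes
  \<open>nest (Suc i')\<close>. This takes \<open>nest i'\<close> at depth 1, which the old margin
  excludes, so one unit of margin is lost.\<close>

lemma shallow_tail:
  assumes "shallow J k s v"
  shows "shallow J k (Suc s) (hw_tail v)"
  unfolding hw_tail_def
proof (rule shallow_Ls)
  fix x assume "x \<in> set (butlast (elems v))"
  then show "\<forall>d i. Suc d + Suc s \<le> J \<longrightarrow> Suc s \<le> i \<longrightarrow> i \<le> k \<longrightarrow> nest i \<notin> objects_at d x"
    using shallow_elem[OF assms in_set_butlastD] by simp
next
  assume J: "Suc s \<le> J"
  show "\<forall>i. Suc s \<le> i \<longrightarrow> i \<le> k \<longrightarrow> Ls (butlast (elems v)) \<noteq> nest i"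
  proof (intro allI impI notI)
    fix i assume i: "Suc s \<le> i" "i \<le> k" "Ls (butlast (elems v)) = nest i"
    then obtain i' where i': "i = Suc i'"
      by (cases i) auto
    then have "nest i' \<in> set (butlast (elems v))"
      using i(3) by simp
    then show False
      using shallow_elem[OF assms in_set_butlastD] J i(1,2) i'
        by (metis add_Suc add_0 Suc_le_mono Suc_leD objects_at.simps(1) singletonI)
  qed
qed

lemma shallow_cons:
  assumes "shallow J k s v" "shallow J k s x"
  shows "shallow J k (Suc s) (hw_cons v x)"
  unfolding hw_cons_def
proof (rule shallow_Ls)
  fix y assume "y \<in> set (elems v @ [x])"
  then show "\<forall>d i. Suc d + Suc s \<le> J \<longrightarrow> Suc s \<le> i \<longrightarrow> i \<le> k \<longrightarrow> nest i \<notin> objects_at d y"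
    using shallow_elem[OF assms(1)] assms(2) by (auto simp: shallow_def)
next
  assume J: "Suc s \<le> J"
  show "\<forall>i. Suc s \<le> i \<longrightarrow> i \<le> k \<longrightarrow> Ls (elems v @ [x]) \<noteq> nest i"
  proof (intro allI impI notI)
    fix i assume i: "Suc s \<le> i" "i \<le> k" "Ls (elems v @ [x]) = nest i"
    then obtain i' where i': "i = Suc i'" "x = nest i'"
      by (cases i) auto
    then show False
      using shallow_neq_nest[OF assms(2), of i'] J i(1,2) by simp
  qed
qed

text \<open>No margin is lost: if a concatenation has exactly one element, one argument already
  equals it. \<open>0 < s\<close> leaves out \<open>nest 0\<close>, which also arises from two
  urelements.\<close>

lemma shallow_conc:
  assumes "shallow J k s v" "shallow J k s w" "0 < s"
  shows "shallow J k s (hw_conc v w)"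
  unfolding hw_conc_def
proof (rule shallow_Ls)
  fix y assume "y \<in> set (elems v @ elems w)"
  then show "\<forall>d i. Suc d + s \<le> J \<longrightarrow> s \<le> i \<longrightarrow> i \<le> k \<longrightarrow> nest i \<notin> objects_at d y"
    using shallow_elem[OF assms(1)] shallow_elem[OF assms(2)] by auto
next
  assume J: "s \<le> J"
  show "\<forall>i. s \<le> i \<longrightarrow> i \<le> k \<longrightarrow> Ls (elems v @ elems w) \<noteq> nest i"
  proof (intro allI impI notI)
    fix i assume i: "s \<le> i" "i \<le> k" "Ls (elems v @ elems w) = nest i"
    then obtain i' where i': "i = Suc i'"
      using assms(3) by (cases i) auto
    then have "v = nest i \<or> w = nest i"
      using i(3) by (cases v; cases w) (auto simp: append_eq_Cons_conv)
    then show False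
      using shallow_neq_nest[OF assms(1) J i(1,2)] shallow_neq_nest[OF assms(2) J i(1,2)] by simp
  qed
qed

text \<open>Everything inside the last element moves up one level, so the depth to which nothing is
  seen shrinks by one.\<close>

lemma shallow_head:
  assumes "shallow J k s v" "0 < s"
  shows "shallow J k (Suc s) (hw_head v)"
proof (cases "elems v = []")
  case True
  then show ?thesis
    by (simp add: hw_head_def shallow_nil)
next
  case False
  then have "last (elems v) \<in> set (elems v)"
    by simp
  from shallow_elem[OF assms(1) this] False show ?thesis
    by (auto simp: shallow_def hw_head_def)
qed

lemma shallow_Ur: "shallow J k s (Ur a)"
proof -
  have "nest i \<noteq> Ur a" for i
    by (cases i) auto
  then have "nest i \<notin> objects_at d (Ur a)" for d i
    by (cases d) auto
  then show ?thesis
    by (simp add: shallow_def)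
qed

lemma str_const_pos: "0 < length (str_const c)"
  by (cases c) auto

lemma length_commas: "sum_list (map length xss) \<le> length (commas xss)"
  by (induction xss rule: commas.induct) auto

text \<open>Each level of nesting costs a pair of brackets in the string, whatever the constant
  symbols denote.\<close>

lemma objects_at_const:
  "nest i \<in> objects_at d (map_hw f c) \<Longrightarrow> i < length (str_const c)"
proof (induction c arbitrary: d i)
  case (Ur a)
  then show ?case
    using shallow_Ur[of "d + i" i i "f a"] by (auto simp: shallow_def)
next
  case (Ls cs)
  show ?case
  proof (cases "i = 0 \<or> cs = []")
    case True
    moreover have "i = 0" if "cs = []"
      using Ls.prems that by (cases d; cases i) auto
    ultimately show ?thesis
      using str_const_pos[of "Ls cs"] by auto
  next
    case False
    obtain c d' i' where c: "c \<in> set cs" "nest i' \<in> objects_at d' (map_hw f c)" "i \<le> Suc i'"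
    proof (cases d)
      case 0
      then obtain i' where "i = Suc i'" "map (map_hw f) cs = [nest i']"
        using Ls.prems False by (cases i) auto
      then show ?thesis
        by (intro that[of "hd cs" i' 0]) auto
    next
      case (Suc d')
      then obtain c where "c \<in> set cs" "nest i \<in> objects_at d' (map_hw f c)"
        using Ls.prems by auto
      then show ?thesis
        by (intro that[of c i d']) auto
    qed
    have "length (str_const c) \<le> sum_list (map length (map str_const cs))"
      using c(1) by (intro member_le_sum_list) auto
    also have "\<dots> \<le> length (commas (map str_const cs))"
      by (rule length_commas)
    finally show ?thesis
      using Ls.IH[OF c(1,2)] c(3) False by simp
  qed
qed

lemma shallow_const:
  assumes "length (str_lterm (LConst cs)) \<le> s"
  shows "shallow J k s (lval M (LConst cs) e)"
  using objects_at_const[of _ _ "const_val M" "Ls cs"] assms by (fastforce simp: shallow_def)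

text \<open>\<open>deepen k\<close> acts elementwise on every list except \<open>nest k\<close>, so
  a list function commutes with it if neither its list arguments nor its result is
  \<open>nest k\<close>. A head is taken over whole instead of being rebuilt, so in
  \<open>deepen_head\<close> only the argument matters; there \<open>0 < k\<close> keeps the default
  nil fixed.\<close>

lemma deepen_tail: "v \<noteq> nest k \<Longrightarrow> hw_tail v \<noteq> nest k \<Longrightarrow> deepen k (hw_tail v) = hw_tail (deepen k v)"
  by (cases v) (auto simp: hw_tail_def map_butlast)

lemma deepen_cons:
  "v \<noteq> nest k \<Longrightarrow> hw_cons v x \<noteq> nest k \<Longrightarrow> deepen k (hw_cons v x) = hw_cons (deepen k v) (deepen k x)"
  by (cases v) (auto simp: hw_cons_def)

lemma deepen_conc:
  "v \<noteq> nest k \<Longrightarrow> w \<noteq> nest k \<Longrightarrow> hw_conc v w \<noteq> nest k \<Longrightarrow>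
    deepen k (hw_conc v w) = hw_conc (deepen k v) (deepen k w)"
  by (cases v; cases w) (auto simp: hw_conc_def)

lemma deepen_head:
  "0 < k \<Longrightarrow> v \<noteq> nest k \<Longrightarrow> deepen k (hw_head v) = hw_head (deepen k v)"
  using deepen_nest[of k 0] by (cases v) (auto simp: hw_head_def last_map)

lemma shallow_neq: "shallow J k s v \<Longrightarrow> s \<le> J \<Longrightarrow> s \<le> k \<Longrightarrow> v \<noteq> nest k"
  by (simp add: shallow_neq_nest)

text \<open>Shallowness is kept for every \<open>J\<close>, so that closed terms can later be
  examined at any depth. Commutation is claimed only while the margin is at most \<open>J\<close>,
  since beyond that shallowness says nothing.\<close>

lemma term_deepen:
  assumes "0 < s" "\<And>x. shallow J k s (e x)" "\<And>x. e' x = deepen k (e x)"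
  shows "standard_lterm t \<Longrightarrow> s + length (str_lterm t) \<le> k \<Longrightarrow>
      shallow J k (s + length (str_lterm t)) (lval M t e) \<and>
      (s + length (str_lterm t) \<le> J \<longrightarrow> lval M t e' = deepen k (lval M t e))"
    and "standard_term a \<Longrightarrow> s + length (str_term a) \<le> k \<Longrightarrow>
      shallow J k (s + length (str_term a)) (tval M a e) \<and>
      (s + length (str_term a) \<le> J \<longrightarrow> tval M a e' = deepen k (tval M a e))"
proof (induction t and a)
  case (LConst cs)
  have "deepen k (lval M (LConst cs) e) = lval M (LConst cs) e"
    using objects_at_const[of k _ "const_val M" "Ls cs"] LConst.prems by (intro deepen_id) fastforce
  then show ?case
    using shallow_const[of cs "s + length (str_lterm (LConst cs))" J k M e] by simp
next
  case (LVar n)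
  then show ?case
    using shallow_mono[OF assms(2)] assms(3) by simp
next
  case (LHead t)
  let ?s = "s + length (str_lterm t)"
  from LHead have IH: "shallow J k ?s (lval M t e)"
    "?s \<le> J \<Longrightarrow> lval M t e' = deepen k (lval M t e)"
    by auto
  have *: "shallow J k (Suc ?s) (hw_head (lval M t e))"
    using IH(1) assms(1) by (intro shallow_head) auto
  moreover have "deepen k (hw_head (lval M t e)) = hw_head (deepen k (lval M t e))" if "?s \<le> J"
    using shallow_neq[OF IH(1) that] LHead.prems(2) assms(1) by (intro deepen_head) auto
  ultimately show ?case
    using IH(2) shallow_mono[OF *, of "s + length (str_lterm (LHead t))"] by simp
next
  case (LTail t)
  let ?s = "s + length (str_lterm t)"
  from LTail have IH: "shallow J k ?s (lval M t e)"
    "?s \<le> J \<Longrightarrow> lval M t e' = deepen k (lval M t e)"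
    by auto
  have *: "shallow J k (Suc ?s) (hw_tail (lval M t e))"
    using IH(1) by (rule shallow_tail)
  moreover have "deepen k (hw_tail (lval M t e)) = hw_tail (deepen k (lval M t e))" if "Suc ?s \<le> J"
    using shallow_neq[OF IH(1)] shallow_neq[OF * that] LTail.prems(2) that by (intro deepen_tail) auto
  ultimately show ?case
    using IH(2) shallow_mono[OF *, of "s + length (str_lterm (LTail t))"] by simp
next
  case (LCons t a)
  let ?s = "s + length (str_lterm t) + length (str_term a)"
  from LCons have IH: "shallow J k ?s (lval M t e)" "shallow J k ?s (tval M a e)"
    "?s \<le> J \<Longrightarrow> lval M t e' = deepen k (lval M t e)"
    "?s \<le> J \<Longrightarrow> tval M a e' = deepen k (tval M a e)"
    by (auto elim: shallow_mono)
  have *: "shallow J k (Suc ?s) (hw_cons (lval M t e) (tval M a e))"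
    using IH(1,2) by (rule shallow_cons)
  moreover have "deepen k (hw_cons (lval M t e) (tval M a e)) =
      hw_cons (deepen k (lval M t e)) (deepen k (tval M a e))" if "Suc ?s \<le> J"
    using shallow_neq[OF IH(1)] shallow_neq[OF * that] LCons.prems(2) that by (intro deepen_cons) auto
  ultimately show ?case
    using IH(3,4) shallow_mono[OF *, of "s + length (str_lterm (LCons t a))"] by simp
next
  case (LConc t u)
  let ?s = "s + length (str_lterm t) + length (str_lterm u)"
  from LConc have IH: "shallow J k ?s (lval M t e)" "shallow J k ?s (lval M u e)"
    "?s \<le> J \<Longrightarrow> lval M t e' = deepen k (lval M t e)"
    "?s \<le> J \<Longrightarrow> lval M u e' = deepen k (lval M u e)"
    by (auto elim: shallow_mono)
  have *: "shallow J k ?s (hw_conc (lval M t e) (lval M u e))"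
    using IH(1,2) assms(1) by (intro shallow_conc) auto
  moreover have "deepen k (hw_conc (lval M t e) (lval M u e)) =
      hw_conc (deepen k (lval M t e)) (deepen k (lval M u e))" if "?s \<le> J"
    using shallow_neq[OF IH(1)] shallow_neq[OF IH(2)] shallow_neq[OF * that] LConc.prems(2) that
    by (intro deepen_conc) auto
  ultimately show ?case
    using IH(3,4) shallow_mono[OF *, of "s + length (str_lterm (LConc t u))"] by simp
next
  case (LRec f y z h t)
  then show ?case by simp
next
  case (TU u)
  then show ?case
    using shallow_mono[OF assms(2)] assms(3) by (cases u) (simp_all add: shallow_Ur)
next
  case (TL t)
  then show ?case by simp
qed

lemma hw_mem_deepen: "v \<noteq> nest k \<Longrightarrow> hw_mem (deepen k a) (deepen k v) \<longleftrightarrow> hw_mem a v"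
  by (cases v) (auto simp: hw_mem_def deepen_inject)

lemma hw_init_deepen:
  assumes "v \<noteq> nest k" "w \<noteq> nest k"
  shows "hw_init (deepen k v) (deepen k w) \<longleftrightarrow> hw_init v w"
proof (cases v; cases w)
  fix xs ys assume *: "v = Ls xs" "w = Ls ys"
  have "prefix (map (deepen k) xs) (map (deepen k) ys) \<longleftrightarrow> prefix xs ys"
    by (metis deepen_inject inj_map_eq_map inj_onI map_mono_prefix prefix_map_rightE)
  then show ?thesis
    using * assms by (simp add: hw_init_def)
qed (use assms in \<open>auto simp: hw_init_def\<close>)

lemma standard_val_cong:
  "standard_lterm t \<Longrightarrow> (\<And>x. x \<in> fv_lterm t \<Longrightarrow> e x = e' x) \<Longrightarrow> lval M t e = lval M t e'"
  "standard_term a \<Longrightarrow> (\<And>x. x \<in> fv_term a \<Longrightarrow> e x = e' x) \<Longrightarrow> tval M a e = tval M a e'"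
proof (induction t and a)
  case (TU u)
  then show ?case by (cases u) auto
qed auto

lemma shallow_default: "0 < s \<Longrightarrow> shallow J k s (default_assignment x)"
  by (cases x) (simp_all add: default_assignment_def shallow_nil shallow_Ur)

text \<open>A closed term does not depend on the assignment, and the values of
  \<open>default_assignment\<close> are shallow for every \<open>J\<close>. Taking \<open>J\<close>
  large enough for depth \<open>d\<close> excludes deep nestings at every depth.\<close>

lemma closed_term_no_nest:
  assumes "standard_lterm t" "fv_lterm t = {}" "1 + length (str_lterm t) \<le> i"
  shows "nest i \<notin> objects_at d (lval M t e)"
proof -
  have "shallow (d + (1 + length (str_lterm t))) i (1 + length (str_lterm t)) (lval M t default_assignment)"
    using assms by (intro conjunct1[OF term_deepen(1)] shallow_default refl) simp_all
  moreover have "lval M t e = lval M t default_assignment"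
    using assms(1,2) by (intro standard_val_cong(1)) auto
  ultimately show ?thesis
    using shallowD assms(3) by fastforce
qed

lemma mem_closed_term_no_nest:
  assumes "standard_lterm t" "fv_lterm t = {}" "1 + length (str_lterm t) \<le> i" "hw_mem a (lval M t e)"
  shows "nest i \<notin> objects_at d a"
  using closed_term_no_nest[OF assms(1-3), of "Suc d" M e] assms(4) by (auto simp: hw_mem_def)

text \<open>One more than for members: an initial segment \<open>Ls [nest i']\<close> of a longer
  list is itself \<open>nest (Suc i')\<close>, although the list contains only
  \<open>nest i'\<close>.\<close>

lemma init_closed_term_no_nest:
  assumes "standard_lterm t" "fv_lterm t = {}" "2 + length (str_lterm t) \<le> i" "hw_init a (lval M t e)"
  shows "nest i \<notin> objects_at d a"
proof -
  obtain xs ys where xs: "a = Ls xs" "lval M t e = Ls ys" "set xs \<subseteq> set ys"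
    using assms(4) by (auto simp: hw_init_def dest: set_mono_prefix)
  obtain i' where i': "i = Suc i'"
    using assms(3) by (cases i) auto
  show ?thesis
  proof (cases d)
    case 0
    then show ?thesis
      using closed_term_no_nest[OF assms(1,2), of i' 1 M e] assms(3) xs i' by auto
  next
    case (Suc d')
    then show ?thesis
      using closed_term_no_nest[OF assms(1,2), of i d M e] assms(3) xs by auto
  qed
qed

text \<open>Atomic formulas are preserved because term values commute with the injective map
  \<open>deepen k\<close>. A bound variable ranges over objects without any \<open>nest i\<close>
  for \<open>s \<le> i\<close>, since its bound is closed and short; \<open>deepen k\<close> fixes
  these, so quantifiers leave the margin \<open>s\<close> intact. Predicates could tell nestings
  apart, but equivalence concerns all structures, and one with empty predicates suffices.\<close>

lemma sat_deepen:
  fixes M :: "'u struct"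
  assumes M: "\<And>P as. \<not> pred_val M P as"
  shows "delta0 \<Sigma> \<phi> \<Longrightarrow> fm_length \<phi> + 2 \<le> s \<Longrightarrow> s + fm_length \<phi> \<le> k \<Longrightarrow>
    (\<And>x. shallow k k s (e x)) \<Longrightarrow> (\<And>x. e' x = deepen k (e x)) \<Longrightarrow> sat M \<phi> e' \<longleftrightarrow> sat M \<phi> e"
proof (induction \<phi> arbitrary: e e')
  case (Eq a b)
  have "tval M a e' = deepen k (tval M a e)" "tval M b e' = deepen k (tval M b e)"
    using Eq.prems term_deepen(2)[where s = s and J = k and k = k and e = e and e' = e', OF _ Eq.prems(4,5)] by (auto simp: delta0_def fm_length_def)
  then show ?case
    by (simp add: deepen_inject)
next
  case (Mem a t)
  have "tval M a e' = deepen k (tval M a e)" "lval M t e' = deepen k (lval M t e)"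
    "shallow k k (s + length (str_lterm t)) (lval M t e)"
    using Mem.prems term_deepen[where s = s and J = k and k = k and e = e and e' = e', OF _ Mem.prems(4,5)] by (auto simp: delta0_def fm_length_def)
  moreover from this(3) have "lval M t e \<noteq> nest k"
    by (rule shallow_neq) (use Mem.prems(3) in \<open>simp_all add: fm_length_def\<close>)
  ultimately show ?case
    by (simp add: hw_mem_deepen)
next
  case (Init t u)
  have "lval M t e' = deepen k (lval M t e)" "lval M u e' = deepen k (lval M u e)"
    "shallow k k (s + length (str_lterm t)) (lval M t e)"
    "shallow k k (s + length (str_lterm u)) (lval M u e)"
    using Init.prems term_deepen(1)[where s = s and J = k and k = k and e = e and e' = e', OF _ Init.prems(4,5)] by (auto simp: delta0_def fm_length_def)
  moreover from this(3) have "lval M t e \<noteq> nest k"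
    by (rule shallow_neq) (use Init.prems(3) in \<open>simp_all add: fm_length_def\<close>)
  moreover from calculation(4) have "lval M u e \<noteq> nest k"
    by (rule shallow_neq) (use Init.prems(3) in \<open>simp_all add: fm_length_def\<close>)
  ultimately show ?case
    by (simp add: hw_init_deepen)
next
  case (Pred P as)
  then show ?case by (simp add: M)
next
  case (Neg \<phi>)
  have "sat M \<phi> e' \<longleftrightarrow> sat M \<phi> e"
    using Neg.prems by (intro Neg.IH) (auto simp: delta0_def fm_length_def)
  then show ?case by simp
next
  case (Conj \<phi> \<psi>)
  have "sat M \<phi> e' \<longleftrightarrow> sat M \<phi> e" "sat M \<psi> e' \<longleftrightarrow> sat M \<psi> e"
    using Conj.prems by (intro Conj.IH; auto simp: delta0_def fm_length_def)+
  then show ?case by simp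
next
  case (Disj \<phi> \<psi>)
  have "sat M \<phi> e' \<longleftrightarrow> sat M \<phi> e" "sat M \<psi> e' \<longleftrightarrow> sat M \<psi> e"
    using Disj.prems by (intro Disj.IH; auto simp: delta0_def fm_length_def)+
  then show ?case by simp
next
  case (Imp \<phi> \<psi>)
  have "sat M \<phi> e' \<longleftrightarrow> sat M \<phi> e" "sat M \<psi> e' \<longleftrightarrow> sat M \<psi> e"
    using Imp.prems by (intro Imp.IH; auto simp: delta0_def fm_length_def)+
  then show ?case by simp
next
  case (AllMem x t \<phi>)
  show ?case
  proof -
    have t: "standard_lterm t" "fv_lterm t = {}" "3 + length (str_lterm t) \<le> s" "s \<le> k"
      using AllMem.prems(1,2,3) by (auto simp: delta0_def fm_length_def)
    have "lval M t e' = lval M t e"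
      using t by (intro standard_val_cong(1)) auto
    moreover have "sat M \<phi> (e'(x := a)) \<longleftrightarrow> sat M \<phi> (e(x := a))" if "hw_mem a (lval M t e)" for a
    proof (rule AllMem.IH)
      have "nest i \<notin> objects_at d a" if "s \<le> i" for i d
        using mem_closed_term_no_nest[OF t(1,2) _ \<open>hw_mem a (lval M t e)\<close>] t(3) that by simp
      then show "shallow k k s ((e(x := a)) y)" "(e'(x := a)) y = deepen k ((e(x := a)) y)" for y
        using AllMem.prems(4,5) t(4) by (auto simp: shallow_def deepen_id)
    qed (use AllMem.prems(1,2,3) in \<open>auto simp: delta0_def fm_length_def\<close>)
    ultimately show ?thesis
      by auto
  qed
next
  case (ExMem x t \<phi>)
  show ?case
  proof -
    have t: "standard_lterm t" "fv_lterm t = {}" "3 + length (str_lterm t) \<le> s" "s \<le> k"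
      using ExMem.prems(1,2,3) by (auto simp: delta0_def fm_length_def)
    have "lval M t e' = lval M t e"
      using t by (intro standard_val_cong(1)) auto
    moreover have "sat M \<phi> (e'(x := a)) \<longleftrightarrow> sat M \<phi> (e(x := a))" if "hw_mem a (lval M t e)" for a
    proof (rule ExMem.IH)
      have "nest i \<notin> objects_at d a" if "s \<le> i" for i d
        using mem_closed_term_no_nest[OF t(1,2) _ \<open>hw_mem a (lval M t e)\<close>] t(3) that by simp
      then show "shallow k k s ((e(x := a)) y)" "(e'(x := a)) y = deepen k ((e(x := a)) y)" for y
        using ExMem.prems(4,5) t(4) by (auto simp: shallow_def deepen_id)
    qed (use ExMem.prems(1,2,3) in \<open>auto simp: delta0_def fm_length_def\<close>)
    ultimately show ?thesis
      by auto
  qed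
next
  case (AllInit n t \<phi>)
  show ?case
  proof -
    have t: "standard_lterm t" "fv_lterm t = {}" "3 + length (str_lterm t) \<le> s" "s \<le> k"
      using AllInit.prems(1,2,3) by (auto simp: delta0_def fm_length_def)
    have "lval M t e' = lval M t e"
      using t by (intro standard_val_cong(1)) auto
    moreover have "sat M \<phi> (e'(LV n := a)) \<longleftrightarrow> sat M \<phi> (e(LV n := a))" if "hw_init a (lval M t e)" for a
    proof (rule AllInit.IH)
      have "nest i \<notin> objects_at d a" if "s \<le> i" for i d
        using init_closed_term_no_nest[OF t(1,2) _ \<open>hw_init a (lval M t e)\<close>] t(3) that by simp
      then show "shallow k k s ((e(LV n := a)) y)" "(e'(LV n := a)) y = deepen k ((e(LV n := a)) y)" for y
        using AllInit.prems(4,5) t(4) by (auto simp: shallow_def deepen_id)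
    qed (use AllInit.prems(1,2,3) in \<open>auto simp: delta0_def fm_length_def\<close>)
    ultimately show ?thesis
      by auto
  qed
next
  case (ExInit n t \<phi>)
  show ?case
  proof -
    have t: "standard_lterm t" "fv_lterm t = {}" "3 + length (str_lterm t) \<le> s" "s \<le> k"
      using ExInit.prems(1,2,3) by (auto simp: delta0_def fm_length_def)
    have "lval M t e' = lval M t e"
      using t by (intro standard_val_cong(1)) auto
    moreover have "sat M \<phi> (e'(LV n := a)) \<longleftrightarrow> sat M \<phi> (e(LV n := a))" if "hw_init a (lval M t e)" for a
    proof (rule ExInit.IH)
      have "nest i \<notin> objects_at d a" if "s \<le> i" for i d
        using init_closed_term_no_nest[OF t(1,2) _ \<open>hw_init a (lval M t e)\<close>] t(3) that by simp
      then show "shallow k k s ((e(LV n := a)) y)" "(e'(LV n := a)) y = deepen k ((e(LV n := a)) y)" for y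
        using ExInit.prems(4,5) t(4) by (auto simp: shallow_def deepen_id)
    qed (use ExInit.prems(1,2,3) in \<open>auto simp: delta0_def fm_length_def\<close>)
    ultimately show ?thesis
      by auto
  qed
qed

section \<open>Exponential growth and the lower bound on length\<close>

lemma poly_nat_mono: "x \<le> y \<Longrightarrow> poly p x \<le> poly (p :: nat poly) y"
  by (induction p) (auto intro: mult_mono)

lemma ex_poly_less_exp: "\<exists>n. poly (q :: nat poly) n < 2 ^ n"
proof -
  have "\<exists>c d. \<forall>n\<ge>1. poly q n \<le> c * n ^ d"
  proof (induction q)
    case (pCons a q)
    then obtain c d where IH: "\<And>n. n \<ge> 1 \<Longrightarrow> poly q n \<le> c * n ^ d"
      by blast
    have "poly (pCons a q) n \<le> (a + c) * n ^ Suc d" if "n \<ge> 1" for n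
    proof -
      have "a + n * poly q n \<le> a * n ^ Suc d + n * (c * n ^ d)"
        using IH[OF that] that by (intro add_mono mult_left_mono) auto
      then show ?thesis
        by (simp add: algebra_simps)
    qed
    then show ?case by blast
  qed simp
  then obtain c d where q: "\<And>n. n \<ge> 1 \<Longrightarrow> poly q n \<le> c * n ^ d"
    by blast
  \<comment> \<open>The witness will be \<open>2 ^ (2 * m)\<close>. At a power of two the claim
    compares exponents, \<open>c + 2 * m * d\<close> against \<open>2 ^ (2 * m)\<close>; this
    \<open>m\<close> makes the former at most \<open>(m + 1) * (m + 1)\<close>.\<close>
  define m where "m = 2 * d + c"
  have "c + 2 * m * d \<le> (m + 1) * (m + 1)"
    by (simp add: m_def algebra_simps)
  also have "\<dots> \<le> 2 ^ m * 2 ^ m"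
    using Suc_leI[OF less_exp[of m]] by (intro mult_mono) simp_all
  finally have m: "c + 2 * m * d \<le> 2 ^ (2 * m)"
    by (simp add: mult_2 power_add)
  have "poly q (2 ^ (2 * m)) \<le> c * (2 ^ (2 * m)) ^ d"
    by (rule q) simp
  also have "\<dots> < 2 ^ c * 2 ^ (2 * m * d)"
    using less_exp[of c] by (simp add: power_mult)
  also have "\<dots> \<le> 2 ^ (2 ^ (2 * m))"
    using m by (simp flip: power_add)
  finally show ?thesis by blast
qed

text \<open>The inner recursion doubles a one-element list \<open>n\<close> times; the outer one
  wraps nil once per element of the result.\<close>

definition nest_fm :: "nat \<Rightarrow> fm" where
  "nest_fm n = Eq (TL (LVar 0)) (TL (LRec (LConst []) 6 7 (LCons (LConst []) (TL (LVar 6)))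
     (LRec (LConst [Ls []]) 6 7 (LConc (LVar 6) (LVar 6)) (LConst (replicate n (Ls []))))))"

lemma sat_nest_fm:
  fixes M :: "'u struct"
  shows "sat M (nest_fm n) e \<longleftrightarrow> e (LV 0) = nest (2 ^ n)"
proof -
  have 1: "foldl (\<lambda>g b. hw_cons (Ls []) g) (nest j :: 'u hw) bs = nest (j + length bs)"
    for j and bs :: "'u hw list"
    by (induction bs arbitrary: j) (simp_all add: hw_cons_def flip: nest.simps(2))
  have 2: "length (elems (foldl (\<lambda>g b. hw_conc g g) (Ls xs) bs)) = length xs * 2 ^ length bs"
    for xs bs :: "'u hw list"
    by (induction bs arbitrary: xs) (simp_all add: hw_conc_def)
  show ?thesis
    using 1[of 0] 2[of "[Ls []]"] by (simp add: nest_fm_def)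
qed

lemma delta0_rec_nest_fm: "delta0_rec \<Sigma> (nest_fm n)"
  by (simp add: nest_fm_def)

lemma fm_length_nest_fm: "fm_length (nest_fm n) \<le> 2 * n + 80"
proof -
  have "length (commas (replicate n [NilS])) \<le> 2 * n"
    by (cases n)
      (simp_all add: commas_replicate length_concat sum_list_replicate map_replicate_const del: replicate_Suc)
  then show ?thesis
    by (simp add: nest_fm_def fm_length_def bin.simps)
qed

lemma objects_at_nest: "objects_at d (nest j) = (if d \<le> j then {nest (j - d)} else {})"
proof (induction d arbitrary: j)
  case (Suc d)
  then show ?case by (cases j) auto
qed simp

theorem no_polynomial_translation:
  "\<not> (\<exists>p :: nat poly. \<forall>\<phi>. delta0_rec \<Sigma> \<phi> \<longrightarrow>
     (\<exists>\<psi>. delta0 \<Sigma> \<psi> \<and> equivalent_fm TYPE('v) \<phi> \<psi> \<and> fm_length \<psi> \<le> poly p (fm_length \<phi>)))"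
proof
  assume "\<exists>p :: nat poly. \<forall>\<phi>. delta0_rec \<Sigma> \<phi> \<longrightarrow>
     (\<exists>\<psi>. delta0 \<Sigma> \<psi> \<and> equivalent_fm TYPE('v) \<phi> \<psi> \<and> fm_length \<psi> \<le> poly p (fm_length \<phi>))"
  then obtain p :: "nat poly" where p: "\<And>\<phi>. delta0_rec \<Sigma> \<phi> \<Longrightarrow>
     \<exists>\<psi>. delta0 \<Sigma> \<psi> \<and> equivalent_fm TYPE('v) \<phi> \<psi> \<and> fm_length \<psi> \<le> poly p (fm_length \<phi>)"
    by blast
  \<comment> \<open>With \<open>N\<close> the length bound for the translation,
    \<open>3 * N + 2 < 2 ^ n\<close> makes \<open>nest (2 ^ n)\<close> shallow: down to depth
    \<open>N\<close> it contains only \<open>nest i\<close> with \<open>i \<ge> 2 ^ n - N\<close>,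
    which is above \<open>2 * N + 2\<close>.\<close>
  obtain n where "poly ([:3:] * pcompose p [:80, 2:] + [:2:]) n < 2 ^ n"
    using ex_poly_less_exp by blast
  then have n: "3 * poly p (2 * n + 80) + 2 < 2 ^ n"
    by (simp add: poly_pcompose algebra_simps)
  define N where "N = poly p (2 * n + 80)"
  obtain \<psi> where \<psi>: "delta0 \<Sigma> \<psi>" "equivalent_fm TYPE('v) (nest_fm n) \<psi>"
    "fm_length \<psi> \<le> poly p (fm_length (nest_fm n))"
    using p[OF delta0_rec_nest_fm] by blast
  have len: "fm_length \<psi> \<le> N"
    using le_trans[OF \<psi>(3) poly_nat_mono[OF fm_length_nest_fm]] by (simp add: N_def)
  define M :: "'v struct" where "M = \<lparr>const_val = (\<lambda>_. undefined), pred_val = (\<lambda>_ _. False)\<rparr>"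
  \<comment> \<open>The initial margin \<open>N + 2\<close> covers the closed bounds, and another
    \<open>N\<close> is the margin that terms can use up.\<close>
  define k where "k = 2 * N + 2"
  define e :: "nat \<Rightarrow> 'v assignment" where "e j = default_assignment(LV 0 := nest j)" for j
  have sorted: "sorted_assignment (e j)" for j
  proof -
    have "\<not> is_ur (nest j :: 'v hw)"
      by (cases j) (auto simp: is_ur_def)
    then show ?thesis
      using sorted_default_assignment[where 'a = 'v] by (simp add: sorted_assignment_def e_def)
  qed
  have "sat M \<psi> (e (Suc (2 ^ n))) \<longleftrightarrow> sat M \<psi> (e (2 ^ n))"
  proof (rule sat_deepen[OF _ \<psi>(1)])
    show "shallow k k (N + 2) (e (2 ^ n) x)" for x
    proof (cases "x = LV 0")
      case True
      then show ?thesis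
        using n by (auto simp: shallow_def objects_at_nest nest_inject e_def k_def N_def)
    qed (simp add: e_def shallow_default)
    have "deepen k (nest (2 ^ n)) = (nest (Suc (2 ^ n)) :: 'v hw)"
      unfolding deepen_nest using n by (simp add: k_def N_def)
    moreover have "deepen k (default_assignment x) = (default_assignment x :: 'v hw)" for x
      using deepen_nest[of k 0] by (cases x) (simp_all add: default_assignment_def k_def)
    ultimately show "e (Suc (2 ^ n)) x = deepen k (e (2 ^ n) x)" for x
      unfolding e_def by (metis fun_upd_apply)
  qed (use len in \<open>simp_all add: M_def k_def\<close>)
  moreover have "sat M \<psi> (e j) \<longleftrightarrow> j = 2 ^ n" for j
    using \<psi>(2) sorted[of j] unfolding equivalent_fm_def by (simp add: sat_nest_fm e_def nest_inject)
  ultimately show False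
    by simp
qed

theorem theorem2:
  fixes \<Sigma> :: signature and M :: "'u struct"
    and m :: nat and D :: "nat list set" and \<nu> :: "nat list \<Rightarrow> 'u hw"
  assumes "ptime_representation \<Sigma> M m D \<nu>"
  shows "(\<forall>k\<ge>1. kEXPTIME_hard k num_syms (true_sentences \<Sigma> M)) \<and>
    \<not> elementary num_syms (true_sentences \<Sigma> M) \<and>
    \<not> (\<exists>p :: nat poly. \<forall>\<phi>. delta0_rec \<Sigma> \<phi> \<longrightarrow>
        (\<exists>\<psi>. delta0 \<Sigma> \<psi> \<and> equivalent_fm TYPE('v) \<phi> \<psi> \<and> fm_length \<psi> \<le> poly p (fm_length \<phi>)))"
  using kEXPTIME_hard_true_sentences not_elementary_true_sentences no_polynomial_translation by blast

end
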